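(* Let $T$ be an unbounded maximal dissipative operator in a complex Hilbert space $\mathcal H$ belonging to the class $\mathbf D_{\rm sing}$, and suppose that $\mathrm{dom}\,T\cap\mathrm{dom}\,T^*$ is non-trivial (i.e. $\neq\{0\}$) and non-dense in $\mathcal H$. Let $\{\mathcal E,\Gamma\}$ be a boundary pair of $T$, let $z\in\mathbb C$ with $\mathrm{Im}\,z>0$, and let $\mathcal T_z$ be the symmetric operator in $\mathfrak H=\mathcal H\oplus\mathcal E$ given by $$\mathrm{dom}\,\mathcal T_z=\left\{\begin{bmatrix}f\\-\frac{\Gamma f}{\sqrt{\mathrm{Im}\,z}}\end{bmatrix}: f\in\mathrm{dom}\,T\right\},\qquad \mathcal T_z\begin{bmatrix}f\\-\frac{\Gamma f}{\sqrt{\mathrm{Im}\,z}}\end{bmatrix}=\begin{bmatrix}Tf\\-\frac{\bar z\,\Gamma f}{\sqrt{\mathrm{Im}\,z}}\end{bmatrix}.$$ Then: (1) the following are equivalent: (i) $\mathrm{dom}\,\mathcal T_z^2$ is dense in $\mathfrak H$; (ii) $\mathcal L_T\cap(\mathrm{dom}\,T\cap\mathrm{dom}\,T^* )^\perp=\{0\}$. (2) the following are equivalent: (i) $\mathrm{dom}\,\mathcal T_z^2$ is non-dense in $\mathfrak H$; (ii) $\mathcal L_T\cap(\mathrm{dom}\,T\cap\mathrm{dom}\,T^* )^\perp\neq\{0\}$.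
   Context: A linear operator $T$ in a complex Hilbert space $\mathcal H$ is dissipative if $\mathrm{Im}(Tf,f)\ge 0$ for all $f\in\mathrm{dom}\,T$, and maximal dissipative if it is dissipative and has no proper dissipative (operator) extension in $\mathcal H$. A maximal dissipative operator is closed and densely defined, and its resolvent set contains the open lower half-plane. $T\in\mathbf D_{\rm sing}$ means that $T$ is maximal dissipative and the quadratic form $\gamma_T[f]=\mathrm{Im}(Tf,f)$, $\mathrm{dom}\,\gamma_T=\mathrm{dom}\,T$, is singular: for every $f\in\mathrm{dom}\,T$ there is a sequence $\{f_n\}\subset\mathrm{dom}\,T$ with $f_n\to f$ in $\mathcal H$ and $\mathrm{Im}(Tf_n,f_n)\to0$. A boundary pair $\{\mathcal E,\Gamma\}$ of a maximal dissipative operator $T$ consists of a Hilbert space $\mathcal E$ and a linear operator $\Gamma:\mathrm{dom}\,T\to\mathcal E$ with range dense in $\mathcal E$ such that $(Tf,g)-(f,Tg)=2i(\Gamma f,\Gamma g)_{\mathcal E}$ for all $f,g\in\mathrm{dom}\,T$. For a bounded operator $B$, $\mathrm{Im}\,B=\frac1{2i}(B-B^* )$. For a maximal dissipative $T$ the bounded operator $\mathrm{Im}\,(T^*-iI)^{-1}$ is nonnegative, and $\mathcal L_T:=\mathrm{ran}\,\bigl(\mathrm{Im}\,(T^*-iI)^{-1}\bigr)^{1/2}$. The square of an operator has domain $\mathrm{dom}\,\mathcal T^2=\{u\in\mathrm{dom}\,\mathcal T:\mathcal Tu\in\mathrm{dom}\,\mathcal T\}$. *)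

theory Defs
  imports "HOL-Analysis.Analysis" "HOL-Library.Nonpos_Ints"
begin

section \<open>Complex Hilbert spaces\<close>

text \<open>
  The distribution only has real inner product spaces. A complex inner product space is a real
  one (which supplies norm and topology) with a compatible complex structure; the form is linear
  in the first and conjugate-linear in the second argument, and its real part is the real inner
  product, so that \<open>cinner x x\<close> is the square of the norm.
\<close>

class complex_inner = real_inner +
  fixes scaleC :: "complex \<Rightarrow> 'a \<Rightarrow> 'a" (infixr "*\<^sub>C" 75)
    and cinner :: "'a \<Rightarrow> 'a \<Rightarrow> complex"
  assumes scaleR_eq_scaleC: "r *\<^sub>R x = of_real r *\<^sub>C x"
    and scaleC_add_right: "a *\<^sub>C (x + y) = a *\<^sub>C x + a *\<^sub>C y"
    and scaleC_add_left: "(a + b) *\<^sub>C x = a *\<^sub>C x + b *\<^sub>C x"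
    and scaleC_scaleC: "a *\<^sub>C (b *\<^sub>C x) = (a * b) *\<^sub>C x"
    and scaleC_one: "1 *\<^sub>C x = x"
    and cinner_commute: "cinner x y = cnj (cinner y x)"
    and cinner_add_left: "cinner (x + y) w = cinner x w + cinner y w"
    and cinner_scaleC_left: "cinner (a *\<^sub>C x) y = a * cinner x y"
    and Re_cinner: "Re (cinner x y) = inner x y"

class complex_hilbert = complex_inner + complete_space

global_interpretation complex_vector: vector_space "scaleC :: complex \<Rightarrow> 'a \<Rightarrow> 'a::complex_inner"
  by unfold_locales (simp_all add: scaleC_add_right scaleC_add_left scaleC_scaleC scaleC_one)

text \<open>
  The orthogonal sum of two complex Hilbert spaces is the product type, with the library's
  \<open>real_inner\<close> structure on products.
\<close>

instantiation prod :: (complex_inner, complex_inner) complex_inner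
begin

definition scaleC_prod_def: "a *\<^sub>C u = (a *\<^sub>C fst u, a *\<^sub>C snd u)"

definition cinner_prod_def: "cinner u v = cinner (fst u) (fst v) + cinner (snd u) (snd v)"

instance
proof
  fix u v w :: "'a \<times> 'b" and a b :: complex and r :: real
  show "r *\<^sub>R u = of_real r *\<^sub>C u"
    by (simp add: scaleC_prod_def prod_eq_iff scaleR_eq_scaleC)
  show "a *\<^sub>C (u + v) = a *\<^sub>C u + a *\<^sub>C v" "(a + b) *\<^sub>C u = a *\<^sub>C u + b *\<^sub>C u"
    "a *\<^sub>C (b *\<^sub>C u) = (a * b) *\<^sub>C u" "1 *\<^sub>C u = u"
    by (simp_all add: scaleC_prod_def scaleC_add_right scaleC_add_left scaleC_scaleC scaleC_one)
  show "cinner u v = cnj (cinner v u)"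
    using cinner_commute[of "fst u" "fst v"] cinner_commute[of "snd u" "snd v"]
    by (simp add: cinner_prod_def)
  show "cinner (u + v) w = cinner u w + cinner v w"
    by (simp add: cinner_prod_def cinner_add_left)
  show "cinner (a *\<^sub>C u) v = a * cinner u v"
    by (simp add: cinner_prod_def scaleC_prod_def cinner_scaleC_left algebra_simps)
  show "Re (cinner u v) = inner u v"
    by (simp add: cinner_prod_def Re_cinner inner_prod_def)
qed

end

instance prod :: (complex_hilbert, complex_hilbert) complex_hilbert ..

definition orth_compl :: "'a::complex_inner set \<Rightarrow> 'a set"
  where "orth_compl S = {x. \<forall>y\<in>S. cinner x y = 0}"


section \<open>Unbounded operators\<close>

text \<open>
  Operators, everywhere defined or not, are partial maps \<open>'a \<rightharpoonup> 'b\<close>. Domain and range are \<open>dom\<close> and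
  \<open>ran\<close>, extension is \<open>\<subseteq>\<^sub>m\<close>, the product of operators with its natural domain is \<open>\<circ>\<^sub>m\<close>, and the
  identity operator is \<open>Some\<close>.
\<close>

abbreviation op_apply :: "('a \<rightharpoonup> 'b) \<Rightarrow> 'a \<Rightarrow> 'b" (infixl "\<cdot>" 90)
  where "T \<cdot> f \<equiv> the (T f)"

definition linear_op :: "('a::complex_inner \<rightharpoonup> 'b::complex_inner) \<Rightarrow> bool"
  where "linear_op T \<longleftrightarrow>
    complex_vector.subspace (dom T) \<and>
    (\<forall>f\<in>dom T. \<forall>g\<in>dom T. T \<cdot> (f + g) = T \<cdot> f + T \<cdot> g) \<and>
    (\<forall>c. \<forall>f\<in>dom T. T \<cdot> (c *\<^sub>C f) = c *\<^sub>C (T \<cdot> f))"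

definition bounded_op :: "('a::complex_inner \<rightharpoonup> 'b::complex_inner) \<Rightarrow> bool"
  where "bounded_op T \<longleftrightarrow> (\<exists>C. \<forall>f\<in>dom T. norm (T \<cdot> f) \<le> C * norm f)"

definition op_diff :: "('a \<rightharpoonup> 'b) \<Rightarrow> ('a \<rightharpoonup> 'b) \<Rightarrow> ('a \<rightharpoonup> 'b::complex_inner)"
  where "op_diff A B = (\<lambda>f. if f \<in> dom A \<inter> dom B then Some (A \<cdot> f - B \<cdot> f) else None)"

definition op_scale :: "complex \<Rightarrow> ('a \<rightharpoonup> 'b) \<Rightarrow> ('a \<rightharpoonup> 'b::complex_inner)"
  where "op_scale c A = (\<lambda>f. map_option (scaleC c) (A f))"

text \<open>
  The next two definitions are used only for an injective \<open>S\<close> and a densely defined \<open>T\<close>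
  respectively, where the uniqueness built into \<open>\<exists>!\<close> is automatic.
\<close>

definition op_inverse :: "('a \<rightharpoonup> 'b) \<Rightarrow> ('b \<rightharpoonup> 'a)"
  where "op_inverse S = (\<lambda>g. if \<exists>!f. S f = Some g then Some (THE f. S f = Some g) else None)"

definition op_adjoint :: "('a::complex_inner \<rightharpoonup> 'b::complex_inner) \<Rightarrow> ('b \<rightharpoonup> 'a)"
  where "op_adjoint T = (\<lambda>g.
    if \<exists>!h. \<forall>f\<in>dom T. cinner (T \<cdot> f) g = cinner f h
    then Some (THE h. \<forall>f\<in>dom T. cinner (T \<cdot> f) g = cinner f h) else None)"

definition op_Im :: "('a \<rightharpoonup> 'a) \<Rightarrow> ('a \<rightharpoonup> 'a::complex_inner)"
  where "op_Im B = op_scale (1 / (2 * \<i>)) (op_diff B (op_adjoint B))"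

definition bounded_nonneg :: "('a::complex_inner \<rightharpoonup> 'a) \<Rightarrow> bool"
  where "bounded_nonneg B \<longleftrightarrow>
    linear_op B \<and> dom B = UNIV \<and> bounded_op B \<and> (\<forall>f. cinner (B \<cdot> f) f \<in> \<real>\<^sub>\<ge>\<^sub>0)"

text \<open>For bounded nonnegative \<open>B\<close> on a Hilbert space this is the unique nonnegative square root.\<close>

definition op_sqrt :: "('a::complex_inner \<rightharpoonup> 'a) \<Rightarrow> ('a \<rightharpoonup> 'a)"
  where "op_sqrt B = (THE R. bounded_nonneg R \<and> R \<circ>\<^sub>m R = B)"


section \<open>Dissipative operators\<close>

definition im_form :: "('a::complex_inner \<rightharpoonup> 'a) \<Rightarrow> 'a \<Rightarrow> real"
  where "im_form T f = Im (cinner (T \<cdot> f) f)"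

definition dissipative :: "('a::complex_inner \<rightharpoonup> 'a) \<Rightarrow> bool"
  where "dissipative T \<longleftrightarrow> linear_op T \<and> (\<forall>f\<in>dom T. im_form T f \<ge> 0)"

text \<open>
  As usual, maximality is understood among densely defined operators. Without density of the
  domain, the absence of a proper dissipative operator extension neither makes \<open>T\<close> closed nor
  gives it a single-valued adjoint: if \<open>h \<noteq> 0\<close>, \<open>T\<^sub>1\<close> is maximal dissipative in the complement of
  \<open>h\<close> and \<open>\<phi>\<close> is a linear functional on \<open>dom T\<^sub>1\<close> that is not \<open>T\<^sub>1\<close>-bounded, then
  \<open>f \<mapsto> T\<^sub>1 f + \<phi>(f) h\<close> has no proper dissipative operator extension.
\<close>

definition maximal_dissipative :: "('a::complex_inner \<rightharpoonup> 'a) \<Rightarrow> bool"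
  where "maximal_dissipative T \<longleftrightarrow>
    dissipative T \<and> closure (dom T) = UNIV \<and> (\<forall>S. dissipative S \<and> T \<subseteq>\<^sub>m S \<longrightarrow> S = T)"

definition D_sing :: "('a::complex_inner \<rightharpoonup> 'a) \<Rightarrow> bool"
  where "D_sing T \<longleftrightarrow> maximal_dissipative T \<and>
    (\<forall>f\<in>dom T. \<exists>F :: nat \<Rightarrow> 'a. range F \<subseteq> dom T \<and> F \<longlonglongrightarrow> f \<and> (\<lambda>n. im_form T (F n)) \<longlonglongrightarrow> 0)"

text \<open>The space \<open>\<E>\<close> of a boundary pair is the whole type \<open>'e\<close>.\<close>

definition boundary_pair :: "('h::complex_hilbert \<rightharpoonup> 'h) \<Rightarrow> ('h \<rightharpoonup> 'e::complex_hilbert) \<Rightarrow> bool"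
  where "boundary_pair T \<Gamma> \<longleftrightarrow>
    maximal_dissipative T \<and> linear_op \<Gamma> \<and> dom \<Gamma> = dom T \<and> closure (ran \<Gamma>) = UNIV \<and>
    (\<forall>f\<in>dom T. \<forall>g\<in>dom T.
      cinner (T \<cdot> f) g - cinner f (T \<cdot> g) = 2 * \<i> * cinner (\<Gamma> \<cdot> f) (\<Gamma> \<cdot> g))"

definition L_space :: "('h::complex_hilbert \<rightharpoonup> 'h) \<Rightarrow> 'h set"
  where "L_space T = ran (op_sqrt (op_Im (op_inverse (op_diff (op_adjoint T) (op_scale \<i> Some)))))"

definition T_z :: "('h::complex_hilbert \<rightharpoonup> 'h) \<Rightarrow> ('h \<rightharpoonup> 'e::complex_hilbert) \<Rightarrow> complex
    \<Rightarrow> ('h \<times> 'e \<rightharpoonup> 'h \<times> 'e)"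
  where "T_z T \<Gamma> z = (\<lambda>(f, e).
    if f \<in> dom T \<and> e = - ((\<Gamma> \<cdot> f) /\<^sub>R sqrt (Im z))
    then Some (T \<cdot> f, - ((cnj z *\<^sub>C (\<Gamma> \<cdot> f)) /\<^sub>R sqrt (Im z))) else None)"

end

theory Submission
  imports Defs
begin

text \<open>
  Write \<open>s\<close> for the square root of \<open>Im z\<close>, \<open>j f = (f, - \<Gamma> f / s)\<close> for the vectors of the domain of the
  symmetric operator, \<open>K f = T f - cnj z f\<close>, and \<open>D\<close> for the intersection of the domains of \<open>T\<close> and
  its adjoint. The proof pairs vectors \<open>w\<close> orthogonal to the domain of the square with vectors
  \<open>g \<in> L_space T\<close> orthogonal to \<open>D\<close> by the relation

    \<open>cinner (j f) w = cinner (K f) g\<close> for all \<open>f \<in> dom T\<close>.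

  Three facts make this work.

  First, singularity of the form gives \<open>D = ker \<Gamma>\<close> (\<open>dom_Int_dom_adjoint_eq_kernel\<close>), and it also makes
  the vectors \<open>j f\<close> total (\<open>Tz_vec_total\<close>). Applying the symmetric operator twice to \<open>j f\<close> is possible
  exactly if \<open>K f\<close> lies in the domain of \<open>T\<close> and is killed by \<open>\<Gamma>\<close>, so the domain of the square is
  \<open>j\<close> of the preimage of \<open>D\<close> under \<open>K\<close> (\<open>dom_T_z_square\<close>).

  Second, \<open>K\<close> maps \<open>dom T\<close> onto the whole space, by maximality
  (\<open>maximal_dissipative_shift_surj\<close>), and \<open>Im z * norm (j f) \<le> norm (K f)\<close>. Hence every \<open>w\<close> has a
  partner \<open>g\<close>, namely a representing vector of the bounded functional that sends \<open>K f\<close> to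
  \<open>cinner (j f) w\<close>. By the relation \<open>w\<close> is orthogonal to the domain of the square if and only if \<open>g\<close>
  is orthogonal to \<open>D\<close>, and \<open>w = 0\<close> if and only if \<open>g = 0\<close>.

  Third, the vectors \<open>g\<close> that have a partner \<open>w\<close> are those with
  \<open>cmod (cinner (K f) g) \<le> C * norm (j f)\<close> for some constant \<open>C\<close>. Up to a term bounded by \<open>norm f\<close> and
  an equivalent norm this condition reads \<open>cmod (cinner (T f) g) \<le> C * norm (f, \<Gamma> f)\<close>, with no
  reference to \<open>z\<close>. For \<open>z = \<i>\<close> and \<open>h = T f + \<i> f\<close> the form of the imaginary part of the
  resolvent at \<open>h\<close> is the squared norm of \<open>(f, \<Gamma> f)\<close>, and the range of a square root is determined
  by its form, so the condition describes \<open>L_space T\<close> (\<open>L_space_eq\<close>).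

  Square roots of bounded nonnegative operators are constructed on the way, together with their
  uniqueness.
\<close>

section \<open>Complex inner products\<close>

lemma cinner_add_right: "cinner x (y + w) = cinner x y + cinner x w"
  by (metis cinner_add_left cinner_commute complex_cnj_add)

lemma cinner_scaleC_right: "cinner x (a *\<^sub>C y) = cnj a * cinner x y"
  by (metis cinner_commute cinner_scaleC_left complex_cnj_mult)

lemma scaleC_minus1: "(-1) *\<^sub>C x = - (x::'a::complex_inner)"
  using scaleR_eq_scaleC[of "-1" x] by simp

lemma cinner_minus_left: "cinner (- x) y = - cinner x y"
  using cinner_scaleC_left[of "-1" x y] by (simp add: scaleC_minus1)

lemma cinner_minus_right: "cinner x (- y) = - cinner x y"
  using cinner_scaleC_right[of x "-1" y] by (simp add: scaleC_minus1)

lemma cinner_diff_left: "cinner (x - y) w = cinner x w - cinner y w"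
  using cinner_add_left[of x "-y" w] by (simp add: cinner_minus_left)

lemma cinner_diff_right: "cinner x (y - w) = cinner x y - cinner x w"
  using cinner_add_right[of x y "-w"] by (simp add: cinner_minus_right)

lemma cinner_scaleR_left: "cinner (r *\<^sub>R x) y = of_real r * cinner x y"
  by (simp add: scaleR_eq_scaleC cinner_scaleC_left)

lemma cinner_scaleR_right: "cinner x (r *\<^sub>R y) = of_real r * cinner x y"
  by (simp add: scaleR_eq_scaleC cinner_scaleC_right)

lemma cinner_zero_left [simp]: "cinner 0 y = 0"
  using cinner_diff_left[of 0 0 y] by simp

lemma cinner_zero_right [simp]: "cinner x 0 = 0"
  using cinner_diff_right[of x 0 0] by simp

lemmas cinner_expand =
  cinner_add_left cinner_add_right cinner_diff_left cinner_diff_right cinner_minus_left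
  cinner_minus_right cinner_scaleC_left cinner_scaleC_right cinner_scaleR_left cinner_scaleR_right

lemma cinner_self: "cinner x x = of_real ((norm x)\<^sup>2)"
proof -
  have "cnj (cinner x x) = cinner x x"
    by (metis cinner_commute)
  then have "Im (cinner x x) = 0"
    by (simp add: complex_eq_iff)
  then show ?thesis
    by (simp add: complex_eq_iff Re_cinner power2_norm_eq_inner)
qed

lemma cinner_self_eq_0: "cinner x x = 0 \<longleftrightarrow> x = 0"
  by (simp add: cinner_self)

lemma cinner_ext: "x = y" if "\<And>w. cinner w x = cinner w y"
proof -
  have "cinner (x - y) (x - y) = 0"
    using that by (simp add: cinner_diff_right)
  then show ?thesis
    by (simp add: cinner_self_eq_0)
qed

lemma norm_scaleC: "norm (a *\<^sub>C x) = cmod a * norm (x::'a::complex_inner)"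
proof -
  have "of_real ((norm (a *\<^sub>C x))\<^sup>2) = cinner (a *\<^sub>C x) (a *\<^sub>C x)"
    by (simp add: cinner_self)
  also have "\<dots> = (a * cnj a) * cinner x x"
    by (simp only: cinner_scaleC_left cinner_scaleC_right mult_ac)
  also have "\<dots> = of_real ((cmod a * norm x)\<^sup>2)"
    by (simp add: complex_norm_square[symmetric] cinner_self power_mult_distrib)
  finally have "(norm (a *\<^sub>C x))\<^sup>2 = (cmod a * norm x)\<^sup>2"
    using of_real_eq_iff by blast
  then show ?thesis
    by (simp add: power2_eq_iff_nonneg)
qed

lemma cinner_cauchy_schwarz: "cmod (cinner x y) \<le> norm x * norm y"
proof (cases "cinner x y = 0")
  case False
  \<comment> \<open>a unimodular factor turns the complex inner product into its modulus\<close>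
  define a where "a = cnj (cinner x y) / cmod (cinner x y)"
  have a: "cmod a = 1"
    using False by (simp add: a_def norm_divide)
  have "a * cinner x y = of_real (cmod (cinner x y))"
    using False by (simp add: a_def complex_norm_square[symmetric] power2_eq_square mult.commute)
  then have "cmod (cinner x y) = inner (a *\<^sub>C x) y"
    by (metis Re_cinner Re_complex_of_real cinner_scaleC_left)
  also have "\<dots> \<le> norm (a *\<^sub>C x) * norm y"
    by (rule norm_cauchy_schwarz)
  finally show ?thesis
    by (simp add: norm_scaleC a)
qed simp

lemma Im_cinner: "Im (cinner x y) = - inner (\<i> *\<^sub>C x) y"
proof -
  have "Re (cinner (\<i> *\<^sub>C x) y) = - Im (cinner x y)"
    by (simp add: cinner_scaleC_left)
  then show ?thesis
    by (simp add: Re_cinner)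
qed

lemma tendsto_scaleC:
  fixes F :: "'b \<Rightarrow> 'a::complex_inner"
  assumes "(F \<longlongrightarrow> x) G"
  shows "((\<lambda>n. a *\<^sub>C F n) \<longlongrightarrow> a *\<^sub>C x) G"
proof (rule Lim_transform_bound[of _ "\<lambda>n. (cmod a) *\<^sub>R norm (F n - x)", THEN LIM_zero_cancel])
  show "\<forall>\<^sub>F n in G. norm (a *\<^sub>C F n - a *\<^sub>C x) \<le> norm (cmod a *\<^sub>R norm (F n - x))"
    by (simp add: norm_scaleC complex_vector.scale_right_diff_distrib[symmetric] abs_mult)
  have "((\<lambda>n. norm (F n - x)) \<longlongrightarrow> 0) G"
    using assms LIM_zero tendsto_norm_zero by blast
  then show "((\<lambda>n. (cmod a) *\<^sub>R norm (F n - x)) \<longlongrightarrow> 0) G"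
    using tendsto_mult_left[of _ 0 G "cmod a"] by simp
qed

lemma tendsto_cinner:
  fixes F H :: "'b \<Rightarrow> 'a::complex_inner"
  assumes "(F \<longlongrightarrow> x) G" "(H \<longlongrightarrow> y) G"
  shows "((\<lambda>n. cinner (F n) (H n)) \<longlongrightarrow> cinner x y) G"
proof -
  have "((\<lambda>n. Re (cinner (F n) (H n))) \<longlongrightarrow> Re (cinner x y)) G"
    using assms by (simp add: Re_cinner tendsto_inner)
  moreover have "((\<lambda>n. Im (cinner (F n) (H n))) \<longlongrightarrow> Im (cinner x y)) G"
    using assms by (simp add: Im_cinner tendsto_inner tendsto_scaleC tendsto_minus)
  ultimately show ?thesis
    by (simp add: tendsto_complex_iff)
qed

lemma cinner_eq_0_if_orth_dense:
  fixes x :: "'a::complex_inner"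
  assumes "closure M = UNIV" "\<And>m. m \<in> M \<Longrightarrow> cinner m x = 0"
  shows "x = 0"
proof -
  obtain F where F: "\<And>n. F n \<in> M" "F \<longlonglongrightarrow> x"
    using assms(1) closure_sequential[of x M] by auto
  have "(\<lambda>n. cinner (F n) x) \<longlonglongrightarrow> cinner x x"
    using F tendsto_cinner tendsto_const by blast
  moreover have "cinner (F n) x = 0" for n
    using F assms by simp
  ultimately show ?thesis
    by (simp add: LIMSEQ_const_iff cinner_self_eq_0)
qed


section \<open>Functionals dominated by a linear map\<close>

definition clinear_on :: "'a::complex_inner set \<Rightarrow> ('a \<Rightarrow> 'b::complex_inner) \<Rightarrow> bool"
  where "clinear_on N f \<longleftrightarrow> complex_vector.subspace N \<and>
    (\<forall>x\<in>N. \<forall>y\<in>N. f (x + y) = f x + f y) \<and> (\<forall>c. \<forall>x\<in>N. f (c *\<^sub>C x) = c *\<^sub>C f x)"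

lemma linear_op_clinear_on: "linear_op T \<longleftrightarrow> clinear_on (dom T) (\<lambda>f. T \<cdot> f)"
  by (simp add: linear_op_def clinear_on_def)

lemma subspace_scaleR: "complex_vector.subspace N \<Longrightarrow> x \<in> N \<Longrightarrow> r *\<^sub>R x \<in> N"
  by (simp add: scaleR_eq_scaleC complex_vector.subspace_scale)

lemma clinear_on_subspace: "clinear_on N f \<Longrightarrow> complex_vector.subspace N"
  by (simp add: clinear_on_def)

lemma clinear_on_add: "clinear_on N f \<Longrightarrow> x \<in> N \<Longrightarrow> y \<in> N \<Longrightarrow> f (x + y) = f x + f y"
  by (simp add: clinear_on_def)

lemma clinear_on_scaleC: "clinear_on N f \<Longrightarrow> x \<in> N \<Longrightarrow> f (c *\<^sub>C x) = c *\<^sub>C f x"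
  by (simp add: clinear_on_def)

lemma clinear_on_scaleR: "clinear_on N f \<Longrightarrow> x \<in> N \<Longrightarrow> f (r *\<^sub>R x) = r *\<^sub>R f x"
  by (simp add: scaleR_eq_scaleC clinear_on_scaleC)

lemma clinear_on_diff:
  assumes "clinear_on N f" "x \<in> N" "y \<in> N"
  shows "f (x - y) = f x - f y"
proof -
  have "f (x + (-1) *\<^sub>R y) = f x + (-1) *\<^sub>R f y"
    using assms clinear_on_add clinear_on_scaleR subspace_scaleR clinear_on_subspace by metis
  then show ?thesis
    by simp
qed

lemma quadratic_nonneg_imp_linear_term_0:
  fixes a b :: real
  assumes "b \<ge> 0" "\<And>t. 2 * t * a + t\<^sup>2 * b \<ge> 0"
  shows "a = 0"
proof (rule ccontr)
  assume "a \<noteq> 0"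
  \<comment> \<open>the minimizer \<open>- a / b\<close> with a denominator that stays positive for \<open>b = 0\<close>\<close>
  define t where "t = - a / (b + 1)"
  have "t * (b + 1) = - a"
    using assms(1) by (simp add: t_def)
  then have "a = - t * b - t"
    by (simp add: algebra_simps)
  then have "2 * t * a = 2 * t * (- t * b - t)"
    by simp
  then have "2 * t * a + t\<^sup>2 * b = - (t\<^sup>2 * (b + 2))"
    by (simp add: algebra_simps power2_eq_square)
  moreover have "t\<^sup>2 * (b + 2) > 0"
    using assms(1) \<open>a \<noteq> 0\<close> by (simp add: t_def)
  ultimately show False
    using assms(2)[of t] by linarith
qed

text \<open>
  A functional \<open>cinner (P n) g\<close> that is bounded by \<open>norm (K n)\<close> factors through \<open>K\<close>. For \<open>K\<close> the
  identity this is the Riesz theorem on a subspace that may fail to be closed, and the general case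
  is Douglas's range inclusion lemma for one vector. Minimizing \<open>(norm (K n))\<^sup>2 - 2 * Re (cinner (P n) g)\<close> over
  \<open>N\<close> handles both at once: images of a minimizing sequence converge to the representing vector,
  so neither an extension of the functional to a closure nor a choice of preimages occurs.
\<close>

lemma dominated_functional_repr:
  fixes P :: "'b::complex_inner \<Rightarrow> 'd::complex_inner" and K :: "'b \<Rightarrow> 'a::complex_hilbert"
  assumes P: "clinear_on N P" and K: "clinear_on N K"
    and bound: "\<And>n. n \<in> N \<Longrightarrow> cmod (cinner (P n) g) \<le> C * norm (K n)"
  obtains w where "w \<in> closure (K ` N)" "\<And>n. n \<in> N \<Longrightarrow> cinner (P n) g = cinner (K n) w"
proof -
  define J where "J n = (norm (K n))\<^sup>2 - 2 * inner (P n) g" for n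
  define I where "I = Inf (J ` N)"
  note subN = clinear_on_subspace[OF P]
  have "0 \<in> N"
    using subN complex_vector.subspace_0 by blast
  have "- C\<^sup>2 \<le> J n" if "n \<in> N" for n
  proof -
    have "inner (P n) g \<le> cmod (cinner (P n) g)"
      by (metis Re_cinner complex_Re_le_cmod)
    then have "inner (P n) g \<le> C * norm (K n)"
      using bound[OF that] by simp
    moreover have "0 \<le> (norm (K n) - C)\<^sup>2"
      by simp
    ultimately show ?thesis
      by (simp add: J_def power2_eq_square algebra_simps)
  qed
  then have bdd: "bdd_below (J ` N)"
    by (auto intro!: bdd_belowI2)
  have I_le: "I \<le> J n" if "n \<in> N" for n
    unfolding I_def using that bdd by (auto intro: cINF_lower)
  have "\<exists>n\<in>N. J n < I + inverse (real (Suc k))" for k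
    using cInf_lessD[of "J ` N" "I + inverse (real (Suc k))"] \<open>0 \<in> N\<close>
    by (fastforce simp: I_def[symmetric])
  then obtain m where m: "\<And>k. m k \<in> N" "\<And>k. J (m k) < I + inverse (real (Suc k))"
    by metis
  have J_lim: "(\<lambda>k. J (m k)) \<longlonglongrightarrow> I"
  proof (rule tendsto_sandwich)
    show "(\<lambda>k. I) \<longlonglongrightarrow> I"
      by simp
    show "(\<lambda>k. I + inverse (real (Suc k))) \<longlonglongrightarrow> I"
      using tendsto_add[OF tendsto_const LIMSEQ_inverse_real_of_nat, of I] by simp
  qed (use m I_le in \<open>auto intro!: always_eventually less_imp_le\<close>)
  \<comment> \<open>the linear term cancels in the parallelogram identity, taken at the midpoint of two vectors\<close>
  have par: "(norm (K x - K y))\<^sup>2 \<le> 2 * (J x - I) + 2 * (J y - I)" if "x \<in> N" "y \<in> N" for x y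
  proof -
    define v where "v = (1/2) *\<^sub>R (x + y)"
    have xy: "x + y \<in> N"
      using subN that complex_vector.subspace_add by blast
    have "v \<in> N"
      using subN xy subspace_scaleR unfolding v_def by blast
    have Kv: "K v = (1/2) *\<^sub>R (K x + K y)" and Pv: "P v = (1/2) *\<^sub>R (P x + P y)"
      unfolding v_def using P K that xy by (simp_all add: clinear_on_scaleR clinear_on_add)
    have "(norm (K x - K y))\<^sup>2 = 2 * J x + 2 * J y - 4 * J v"
      unfolding J_def Kv Pv
      by (simp add: power2_norm_eq_inner inner_add_left inner_add_right inner_diff_left
          inner_diff_right inner_commute algebra_simps)
    then show ?thesis
      using I_le[OF \<open>v \<in> N\<close>] by simp
  qed
  have "Cauchy (\<lambda>k. K (m k))"
  proof (rule CauchyI)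
    fix e :: real
    assume "e > 0"
    have "(\<lambda>k. J (m k) - I) \<longlonglongrightarrow> 0"
      using J_lim LIM_zero by blast
    then have "\<forall>\<^sub>F k in sequentially. J (m k) - I < e\<^sup>2 / 4"
      using \<open>e > 0\<close> by (intro order_tendstoD) auto
    then obtain k0 where k0: "\<And>k. k \<ge> k0 \<Longrightarrow> J (m k) - I < e\<^sup>2 / 4"
      unfolding eventually_sequentially by blast
    have "norm (K (m k) - K (m l)) < e" if "k \<ge> k0" "l \<ge> k0" for k l
    proof -
      have "(norm (K (m k) - K (m l)))\<^sup>2 < e\<^sup>2"
        using par[OF m(1)[of k] m(1)[of l]] k0[OF that(1)] k0[OF that(2)] by simp
      then show ?thesis
        using \<open>e > 0\<close> by (simp add: power2_less_imp_less)
    qed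
    then show "\<exists>M. \<forall>k\<ge>M. \<forall>l\<ge>M. norm (K (m k) - K (m l)) < e"
      by blast
  qed
  then obtain w where w: "(\<lambda>k. K (m k)) \<longlonglongrightarrow> w"
    using Cauchy_convergent_iff convergent_def by blast
  have re: "inner (P n) g = inner (K n) w" if "n \<in> N" for n
  proof -
    have "2 * t * (inner (K n) w - inner (P n) g) + t\<^sup>2 * (norm (K n))\<^sup>2 \<ge> 0" for t
    proof -
      have ineq: "I \<le> J (m k) + 2 * t * (inner (K n) (K (m k)) - inner (P n) g) + t\<^sup>2 * (norm (K n))\<^sup>2"
        for k
      proof -
        have tn: "t *\<^sub>R n \<in> N"
          using subN that subspace_scaleR by blast
        have "J (m k + t *\<^sub>R n) = J (m k) + 2 * t * (inner (K n) (K (m k)) - inner (P n) g)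
            + t\<^sup>2 * (norm (K n))\<^sup>2"
          unfolding J_def using P K that m(1) tn
          by (simp add: clinear_on_scaleR clinear_on_add power2_norm_eq_inner inner_add_left
              inner_add_right inner_commute algebra_simps power2_eq_square[of t])
        then show ?thesis
          using I_le complex_vector.subspace_add[OF subN m(1)[of k] tn] by metis
      qed
      have "(\<lambda>k. J (m k) + 2 * t * (inner (K n) (K (m k)) - inner (P n) g) + t\<^sup>2 * (norm (K n))\<^sup>2)
          \<longlonglongrightarrow> I + 2 * t * (inner (K n) w - inner (P n) g) + t\<^sup>2 * (norm (K n))\<^sup>2"
        by (intro tendsto_intros J_lim w)
      then have "I \<le> I + 2 * t * (inner (K n) w - inner (P n) g) + t\<^sup>2 * (norm (K n))\<^sup>2"
        by (rule LIMSEQ_le_const) (use ineq in blast)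
      then show ?thesis
        by simp
    qed
    then have "inner (K n) w - inner (P n) g = 0"
      by (rule quadratic_nonneg_imp_linear_term_0[OF zero_le_power2])
    then show ?thesis
      by simp
  qed
  show thesis
  proof (rule that)
    show "w \<in> closure (K ` N)"
      unfolding closure_sequential using w m(1) by (intro exI[of _ "\<lambda>k. K (m k)"]) auto
    fix n
    assume n: "n \<in> N"
    have "inner (P (\<i> *\<^sub>C n)) g = inner (K (\<i> *\<^sub>C n)) w"
      using re n subN complex_vector.subspace_scale by blast
    then show "cinner (P n) g = cinner (K n) w"
      using re[OF n] n P K by (simp add: complex_eq_iff Re_cinner Im_cinner clinear_on_scaleC)
  qed
qed

lemma clinear_on_id: "complex_vector.subspace N \<Longrightarrow> clinear_on N (\<lambda>x. x)"
  by (simp add: clinear_on_def)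

text \<open>
  The vector that represents \<open>cinner m x\<close> on \<open>M\<close> and lies in the closure of \<open>M\<close> is the orthogonal
  projection of \<open>x\<close>.
\<close>

lemma nondense_subspace_orth:
  fixes M :: "'a::complex_hilbert set"
  assumes "complex_vector.subspace M" "closure M \<noteq> UNIV"
  obtains n where "n \<noteq> 0" "\<And>m. m \<in> M \<Longrightarrow> cinner m n = 0"
proof -
  obtain x where x: "x \<notin> closure M"
    using assms by blast
  have "cmod (cinner m x) \<le> norm x * norm m" for m
    using cinner_cauchy_schwarz[of m x] by (simp add: mult.commute)
  then obtain w where w: "w \<in> closure M" "\<And>m. m \<in> M \<Longrightarrow> cinner m x = cinner m w"
    using dominated_functional_repr[OF clinear_on_id clinear_on_id, where N = M and g = x and C = "norm x"] assms(1)
    by auto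
  show thesis
  proof (rule that[of "x - w"])
    show "x - w \<noteq> 0"
      using x w by auto
  qed (use w in \<open>simp add: cinner_diff_right\<close>)
qed

section \<open>Square roots of nonnegative operators\<close>

text \<open>
  Everywhere defined operators are treated as total functions; \<open>bounded_nonneg_Some\<close> translates.
\<close>

definition nonneg_map :: "('a::complex_inner \<Rightarrow> 'a) \<Rightarrow> bool"
  where "nonneg_map B \<longleftrightarrow> clinear_on UNIV B \<and> (\<exists>C. \<forall>x. norm (B x) \<le> C * norm x) \<and>
    (\<forall>x. cinner (B x) x \<in> \<real>\<^sub>\<ge>\<^sub>0)"

lemma bounded_nonneg_Some: "bounded_nonneg (\<lambda>x. Some (B x)) \<longleftrightarrow> nonneg_map B"
  by (auto simp: bounded_nonneg_def nonneg_map_def bounded_op_def linear_op_clinear_on dom_def)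

lemma total_map_eq_Some: "dom R = UNIV \<Longrightarrow> R = (\<lambda>x. Some (R \<cdot> x))"
  by (metis UNIV_I domD ext option.sel)

lemma nonneg_map_linear: "nonneg_map B \<Longrightarrow> clinear_on UNIV B"
  by (simp add: nonneg_map_def)

lemma nonneg_map_bound:
  assumes "nonneg_map B"
  obtains c where "c > 0" "\<And>x. norm (B x) \<le> c * norm x"
proof -
  obtain C where C: "\<And>x. norm (B x) \<le> C * norm x"
    using assms by (auto simp: nonneg_map_def)
  have "norm (B x) \<le> (\<bar>C\<bar> + 1) * norm x" for x
    by (rule order_trans[OF C mult_right_mono]) auto
  then show thesis
    by (intro that[of "\<bar>C\<bar> + 1"]) auto
qed

lemma nonneg_map_inner: "nonneg_map B \<Longrightarrow> inner (B x) x \<ge> 0"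
  by (metis Re_cinner complex_nonneg_Reals_iff nonneg_map_def)

lemma nonneg_map_symmetric:
  assumes "nonneg_map B"
  shows "cinner (B x) y = cinner x (B y)"
proof -
  note lin = nonneg_map_linear[OF assms]
  define D where "D x y = cinner (B x) y - cinner x (B y)" for x y
  have D0: "D x x = 0" for x
  proof -
    have "Im (cinner (B x) x) = 0"
      using assms by (simp add: nonneg_map_def complex_nonneg_Reals_iff)
    moreover have "cinner x (B x) = cnj (cinner (B x) x)"
      by (rule cinner_commute)
    ultimately show ?thesis
      by (simp add: D_def complex_eq_iff)
  qed
  \<comment> \<open>polarization: a sesquilinear form that vanishes on the diagonal is zero\<close>
  have "D x y + D y x = 0"
    using D0[of "x + y"] D0[of x] D0[of y]
    by (simp add: D_def clinear_on_add[OF lin] cinner_expand algebra_simps)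
  moreover have "\<i> * D x y - \<i> * D y x = 0"
    using D0[of "\<i> *\<^sub>C x + y"] D0[of x] D0[of y]
    by (simp add: D_def clinear_on_add[OF lin] clinear_on_scaleC[OF lin] cinner_expand algebra_simps)
  ultimately have "D x y = 0"
    by (simp add: right_diff_distrib[symmetric] del: mult_cancel_left)
  then show ?thesis
    by (simp add: D_def)
qed

text \<open>
  Positivity of the form at \<open>x - B x / c\<close> controls the vector \<open>B x\<close> by the form alone.
\<close>

lemma nonneg_map_norm_le_form:
  assumes B: "nonneg_map B" and c: "c > 0" "\<And>x. norm (B x) \<le> c * norm x"
  shows "(norm (B x))\<^sup>2 \<le> c * inner (B x) x"
proof -
  note lin = nonneg_map_linear[OF B]
  define u where "u = (1/c) *\<^sub>R B x"
  have sym: "inner (B u) x = inner u (B x)"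
    using nonneg_map_symmetric[OF B] by (metis Re_cinner)
  have "inner (B u) u \<le> norm (B u) * norm u"
    by (rule norm_cauchy_schwarz)
  also have "\<dots> \<le> c * norm u * norm u"
    using c(2)[of u] mult_right_mono norm_ge_zero by blast
  also have "\<dots> = (norm (B x))\<^sup>2 / c"
    using c(1) by (simp add: u_def power2_eq_square)
  finally have "inner (B u) u \<le> (norm (B x))\<^sup>2 / c" .
  moreover have "0 \<le> inner (B (x - u)) (x - u)"
    by (rule nonneg_map_inner[OF B])
  moreover have "inner (B (x - u)) (x - u) = inner (B x) x - 2 * ((norm (B x))\<^sup>2 / c) + inner (B u) u"
    using sym by (simp add: clinear_on_diff[OF lin] inner_diff_left inner_diff_right u_def
        power2_norm_eq_inner inner_commute)
  ultimately have "(norm (B x))\<^sup>2 / c \<le> inner (B x) x"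
    by linarith
  then show ?thesis
    using c(1) by (simp add: field_simps)
qed

lemma nonneg_map_eq_0_if_form_0:
  assumes "nonneg_map B" "inner (B x) x = 0"
  shows "B x = 0"
proof -
  obtain c where "c > 0" "\<And>x. norm (B x) \<le> c * norm x"
    using nonneg_map_bound assms by blast
  then have "(norm (B x))\<^sup>2 \<le> 0"
    using nonneg_map_norm_le_form[OF assms(1)] assms(2) by (metis mult_zero_right)
  then show ?thesis
    by simp
qed

text \<open>
  The square root of \<open>1 - a\<close> is \<open>1 - y\<close>, where \<open>y\<close> solves \<open>y = (a + y\<^sup>2) / 2\<close>. The fixed point
  iteration for \<open>y\<close> is run on operators and, with \<open>a = 1\<close>, on numbers; the scalar iteration
  majorizes the operator iteration and its increments whenever \<open>A\<close> is a contraction.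
\<close>

primrec sqrt_iter :: "('a::complex_inner \<Rightarrow> 'a) \<Rightarrow> nat \<Rightarrow> 'a \<Rightarrow> 'a" where
  "sqrt_iter A 0 = (\<lambda>x. 0)"
| "sqrt_iter A (Suc n) = (\<lambda>x. (1/2) *\<^sub>R (A x + sqrt_iter A n (sqrt_iter A n x)))"

primrec majorant_iter :: "nat \<Rightarrow> real" where
  "majorant_iter 0 = 0"
| "majorant_iter (Suc n) = (1 + (majorant_iter n)\<^sup>2) / 2"

lemma majorant_iter_bounds: "0 \<le> majorant_iter n \<and> majorant_iter n \<le> 1"
proof (induction n)
  case (Suc n)
  then have "(majorant_iter n)\<^sup>2 \<le> 1"
    by (simp add: power_le_one)
  then show ?case
    by simp
qed simp

lemma majorant_iter_mono: "majorant_iter n \<le> majorant_iter (Suc n)"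
proof -
  have "0 \<le> (1 - majorant_iter n)\<^sup>2"
    by simp
  then show ?thesis
    by (simp add: power2_eq_square algebra_simps)
qed

lemma majorant_iter_convergent: "convergent majorant_iter"
proof (rule Bseq_monoseq_convergent)
  show "Bseq majorant_iter"
    using majorant_iter_bounds by (intro BseqI'[of _ 1]) simp
  show "monoseq majorant_iter"
    using majorant_iter_mono by (simp add: monoseq_Suc)
qed

lemma sqrt_iter_linear: "clinear_on UNIV A \<Longrightarrow> clinear_on UNIV (sqrt_iter A n)"
proof (induction n)
  case 0
  then show ?case
    by (simp add: clinear_on_def)
next
  case (Suc n)
  have A: "A (x + y) = A x + A y" "A (c *\<^sub>C x) = c *\<^sub>C A x" for x y c
    using Suc.prems by (simp_all add: clinear_on_def)
  have Y: "sqrt_iter A n (x + y) = sqrt_iter A n x + sqrt_iter A n y"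
    "sqrt_iter A n (c *\<^sub>C x) = c *\<^sub>C sqrt_iter A n x" for x y c
    using Suc by (simp_all add: clinear_on_def)
  show ?case
    using complex_vector.subspace_UNIV
    by (simp add: clinear_on_def A Y algebra_simps scaleR_eq_scaleC scaleC_add_right scaleC_scaleC
        mult.commute)
qed

lemma sqrt_iter_symmetric:
  assumes "\<And>x y. cinner (A x) y = cinner x (A y)"
  shows "cinner (sqrt_iter A n x) y = cinner x (sqrt_iter A n y)"
  by (induction n arbitrary: x y) (simp_all add: cinner_expand assms)

lemma sqrt_iter_commute:
  assumes "\<And>x. A (P x) = P (A x)" and P: "clinear_on UNIV P"
  shows "sqrt_iter A n (P x) = P (sqrt_iter A n x)"
proof (induction n arbitrary: x)
  case 0
  show ?case
    using clinear_on_diff[OF P, of x x] clinear_on_diff[OF P, of 0 0] by simp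
next
  case (Suc n)
  then show ?case
    by (simp add: assms(1) clinear_on_add[OF P] clinear_on_scaleR[OF P])
qed

lemma sqrt_iter_norm:
  assumes "\<And>x. norm (A x) \<le> norm x"
  shows "norm (sqrt_iter A n x) \<le> majorant_iter n * norm x"
proof (induction n arbitrary: x)
  case (Suc n)
  have "norm (sqrt_iter A n (sqrt_iter A n x)) \<le> majorant_iter n * norm (sqrt_iter A n x)"
    by (rule Suc)
  also have "\<dots> \<le> majorant_iter n * (majorant_iter n * norm x)"
    using Suc majorant_iter_bounds by (intro mult_left_mono) auto
  finally have "norm (A x + sqrt_iter A n (sqrt_iter A n x)) \<le> norm x + (majorant_iter n)\<^sup>2 * norm x"
    using assms[of x] norm_triangle_ineq[of "A x" "sqrt_iter A n (sqrt_iter A n x)"]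
    by (simp add: power2_eq_square mult.assoc)
  then show ?case
    by (simp add: distrib_right del: scaleR_right_distrib)
qed simp

lemma sqrt_iter_step:
  assumes lin: "clinear_on UNIV A" and contr: "\<And>x. norm (A x) \<le> norm x"
  shows "norm (sqrt_iter A (Suc n) x - sqrt_iter A n x)
    \<le> (majorant_iter (Suc n) - majorant_iter n) * norm x"
proof (induction n arbitrary: x)
  case 0
  show ?case
    using contr[of x] by simp
next
  case (Suc n)
  define Y where "Y = sqrt_iter A n"
  define Y' where "Y' = sqrt_iter A (Suc n)"
  define y where "y = majorant_iter n"
  define y' where "y' = majorant_iter (Suc n)"
  have step: "norm (Y' x - Y x) \<le> (y' - y) * norm x" for x
    using Suc unfolding Y_def Y'_def y_def y'_def by blast
  have y: "0 \<le> y" "0 \<le> y'" "y \<le> y'"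
    unfolding y_def y'_def using majorant_iter_bounds majorant_iter_mono by blast+
  have Y': "norm (Y' x) \<le> y' * norm x" and Y: "norm (Y x) \<le> y * norm x" for x
    unfolding y_def y'_def Y_def Y'_def by (rule sqrt_iter_norm[OF contr])+
  have linY': "clinear_on UNIV Y'"
    unfolding Y'_def by (rule sqrt_iter_linear[OF lin])
  have "Y' (Y' x) - Y (Y x) = Y' (Y' x - Y x) + (Y' (Y x) - Y (Y x))"
    by (simp add: clinear_on_diff[OF linY'])
  then have "norm (Y' (Y' x) - Y (Y x)) \<le> norm (Y' (Y' x - Y x)) + norm (Y' (Y x) - Y (Y x))"
    by (metis norm_triangle_ineq)
  also have "\<dots> \<le> y' * norm (Y' x - Y x) + (y' - y) * norm (Y x)"
    by (intro add_mono Y' step)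
  also have "\<dots> \<le> y' * ((y' - y) * norm x) + (y' - y) * (y * norm x)"
    using y by (intro add_mono mult_left_mono step Y) auto
  finally have *: "norm (Y' (Y' x) - Y (Y x)) \<le> (y'\<^sup>2 - y\<^sup>2) * norm x"
    by (simp add: power2_eq_square algebra_simps)
  have "sqrt_iter A (Suc (Suc n)) x - sqrt_iter A (Suc n) x
      = (1/2) *\<^sub>R (A x + Y' (Y' x)) - (1/2) *\<^sub>R (A x + Y (Y x))"
    by (simp add: Y_def Y'_def)
  also have "\<dots> = (1/2) *\<^sub>R (Y' (Y' x) - Y (Y x))"
    by (simp add: algebra_simps)
  finally have "norm (sqrt_iter A (Suc (Suc n)) x - sqrt_iter A (Suc n) x)
      \<le> (y'\<^sup>2 - y\<^sup>2) * norm x / 2"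
    using * by simp
  also have "\<dots> = (majorant_iter (Suc (Suc n)) - majorant_iter (Suc n)) * norm x"
    by (simp add: y_def y'_def field_simps)
  finally show ?case .
qed

lemma sqrt_iter_cauchy_bound:
  assumes lin: "clinear_on UNIV A" and contr: "\<And>x. norm (A x) \<le> norm x"
  shows "norm (sqrt_iter A (n + k) x - sqrt_iter A n x)
    \<le> (majorant_iter (n + k) - majorant_iter n) * norm x"
proof (induction k)
  case (Suc k)
  have "norm (sqrt_iter A (n + Suc k) x - sqrt_iter A n x)
      \<le> norm (sqrt_iter A (Suc (n + k)) x - sqrt_iter A (n + k) x)
        + norm (sqrt_iter A (n + k) x - sqrt_iter A n x)"
    using norm_triangle_ineq[of "sqrt_iter A (Suc (n + k)) x - sqrt_iter A (n + k) x"
        "sqrt_iter A (n + k) x - sqrt_iter A n x"] by simp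
  also have "\<dots> \<le> (majorant_iter (Suc (n + k)) - majorant_iter (n + k)) * norm x
      + (majorant_iter (n + k) - majorant_iter n) * norm x"
    by (intro add_mono Suc sqrt_iter_step[OF lin contr])
  also have "\<dots> = (majorant_iter (n + Suc k) - majorant_iter n) * norm x"
    by (simp add: algebra_simps)
  finally show ?case .
qed simp

lemma sqrt_iter_convergent:
  fixes A :: "'a::complex_hilbert \<Rightarrow> 'a"
  assumes lin: "clinear_on UNIV A" and contr: "\<And>x. norm (A x) \<le> norm x"
  shows "convergent (\<lambda>n. sqrt_iter A n x)"
proof -
  have "Cauchy (\<lambda>n. sqrt_iter A n x)"
  proof (rule metric_CauchyI)
    fix e :: real
    assume "e > 0"
    then have "e / (norm x + 1) > 0"
      using norm_ge_zero[of x] by (intro divide_pos_pos) linarith+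
    then obtain M where M: "\<And>m n. m \<ge> M \<Longrightarrow> n \<ge> M
        \<Longrightarrow> norm (majorant_iter m - majorant_iter n) < e / (norm x + 1)"
      using CauchyD[of majorant_iter] majorant_iter_convergent convergent_Cauchy by blast
    have "norm (sqrt_iter A m x - sqrt_iter A n x) < e" if mn: "m \<ge> M" "n > m" for m n
    proof -
      obtain k where k: "n = m + k"
        using mn(2) less_imp_add_positive by blast
      have "norm (sqrt_iter A n x - sqrt_iter A m x) \<le> (majorant_iter n - majorant_iter m) * norm x"
        unfolding k by (rule sqrt_iter_cauchy_bound[OF lin contr])
      also have "\<dots> \<le> e / (norm x + 1) * norm x"
        using M[of n m] mn by (intro mult_right_mono) auto
      also have "\<dots> < e"
        using \<open>e > 0\<close> by (simp add: pos_divide_less_eq add_nonneg_pos)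
      finally show ?thesis
        by (simp add: norm_minus_commute)
    qed
    then have "dist (sqrt_iter A m x) (sqrt_iter A n x) < e" if "m \<ge> M" "n \<ge> M" for m n
      using that \<open>e > 0\<close> by (metis dist_commute dist_norm dist_self linorder_neqE_nat)
    then show "\<exists>M. \<forall>m\<ge>M. \<forall>n\<ge>M. dist (sqrt_iter A m x) (sqrt_iter A n x) < e"
      by blast
  qed
  then show ?thesis
    using Cauchy_convergent_iff by blast
qed

text \<open>
  Besides being a square root, the root obtained from the iteration commutes with every
  nonnegative operator that commutes with \<open>B\<close>, in particular with any other nonnegative root; this
  is what uniqueness rests on.
\<close>

lemma nonneg_map_sqrt_exists:
  fixes B :: "'a::complex_hilbert \<Rightarrow> 'a"
  assumes B: "nonneg_map B"
  obtains S where "nonneg_map S" "\<And>x. S (S x) = B x"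
    "\<And>P x. nonneg_map P \<Longrightarrow> (\<And>x. P (B x) = B (P x)) \<Longrightarrow> P (S x) = S (P x)"
proof -
  obtain c where c: "c > 0" "\<And>x. norm (B x) \<le> c * norm x"
    using nonneg_map_bound B by blast
  note linB = nonneg_map_linear[OF B]
  define A where "A x = x - (1/c) *\<^sub>R B x" for x
  have linA: "clinear_on UNIV A"
    using linB unfolding clinear_on_def A_def
    by (simp add: scaleR_eq_scaleC scaleC_add_right scaleC_scaleC mult.commute
        complex_vector.scale_right_diff_distrib)
  have symA: "cinner (A x) y = cinner x (A y)" for x y
    by (simp add: A_def cinner_expand nonneg_map_symmetric[OF B])
  have contr: "norm (A x) \<le> norm x" for x
  proof -
    have "(norm (A x))\<^sup>2 = (norm x)\<^sup>2 - (2/c) * inner (B x) x + (norm (B x))\<^sup>2 / c\<^sup>2"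
      unfolding A_def power2_norm_eq_inner
      by (simp add: inner_diff_left inner_diff_right inner_commute power2_eq_square)
    also have "(norm (B x))\<^sup>2 / c\<^sup>2 \<le> inner (B x) x / c"
      using nonneg_map_norm_le_form[OF B c, of x] c(1)
      by (simp add: power2_eq_square divide_simps mult.commute)
    also have "(norm x)\<^sup>2 - (2/c) * inner (B x) x + inner (B x) x / c
        = (norm x)\<^sup>2 - inner (B x) x / c"
      by (simp add: field_simps)
    also have "\<dots> \<le> (norm x)\<^sup>2"
      using nonneg_map_inner[OF B, of x] c(1) by simp
    finally show ?thesis
      by (simp add: power2_le_iff_abs_le)
  qed
  define Y where "Y x = lim (\<lambda>n. sqrt_iter A n x)" for x
  have Y: "(\<lambda>n. sqrt_iter A n x) \<longlonglongrightarrow> Y x" for x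
    unfolding Y_def using sqrt_iter_convergent[OF linA contr] convergent_LIMSEQ_iff by blast
  have linY: "clinear_on UNIV Y"
  proof -
    have "Y (x + y) = Y x + Y y" for x y
    proof (rule LIMSEQ_unique[OF Y])
      show "(\<lambda>n. sqrt_iter A n (x + y)) \<longlonglongrightarrow> Y x + Y y"
        using tendsto_add[OF Y Y, of x y] by (simp add: clinear_on_add[OF sqrt_iter_linear[OF linA]])
    qed
    moreover have "Y (a *\<^sub>C x) = a *\<^sub>C Y x" for a x
    proof (rule LIMSEQ_unique[OF Y])
      show "(\<lambda>n. sqrt_iter A n (a *\<^sub>C x)) \<longlonglongrightarrow> a *\<^sub>C Y x"
        using tendsto_scaleC[OF Y, of a x] by (simp add: clinear_on_scaleC[OF sqrt_iter_linear[OF linA]])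
    qed
    ultimately show ?thesis
      by (simp add: clinear_on_def)
  qed
  have iter_le: "norm (sqrt_iter A n x) \<le> norm x" for n x
  proof -
    have "majorant_iter n * norm x \<le> 1 * norm x"
      using majorant_iter_bounds by (intro mult_right_mono) auto
    then show ?thesis
      using sqrt_iter_norm[of A n x] contr by simp
  qed
  have normY: "norm (Y x) \<le> norm x" for x
    by (rule LIMSEQ_le_const2[OF tendsto_norm[OF Y]]) (use iter_le in blast)
  have symY: "cinner (Y x) y = cinner x (Y y)" for x y
  proof (rule LIMSEQ_unique[OF tendsto_cinner[OF Y tendsto_const]])
    show "(\<lambda>n. cinner (sqrt_iter A n x) y) \<longlonglongrightarrow> cinner x (Y y)"
      using tendsto_cinner[OF tendsto_const Y] by (simp add: sqrt_iter_symmetric[of A, OF symA])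
  qed
  have fix_pt: "2 *\<^sub>R Y x = A x + Y (Y x)" for x
  proof -
    have "(\<lambda>n. sqrt_iter A n (sqrt_iter A n x - Y x)) \<longlonglongrightarrow> 0"
    proof (rule Lim_null_comparison)
      show "\<forall>\<^sub>F n in sequentially. norm (sqrt_iter A n (sqrt_iter A n x - Y x))
          \<le> norm (sqrt_iter A n x - Y x)"
        using iter_le by simp
      show "(\<lambda>n. norm (sqrt_iter A n x - Y x)) \<longlonglongrightarrow> 0"
        using Y LIM_zero tendsto_norm_zero by blast
    qed
    then have "(\<lambda>n. sqrt_iter A n (sqrt_iter A n x - Y x) + sqrt_iter A n (Y x)) \<longlonglongrightarrow> 0 + Y (Y x)"
      by (intro tendsto_add Y)
    then have "(\<lambda>n. (1/2) *\<^sub>R (A x + sqrt_iter A n (sqrt_iter A n x)))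
        \<longlonglongrightarrow> (1/2) *\<^sub>R (A x + Y (Y x))"
      by (intro tendsto_intros) (simp add: clinear_on_diff[OF sqrt_iter_linear[OF linA]])
    moreover have "(\<lambda>n. sqrt_iter A (Suc n) x) \<longlonglongrightarrow> Y x"
      using Y LIMSEQ_Suc by blast
    ultimately have "Y x = (1/2) *\<^sub>R (A x + Y (Y x))"
      using LIMSEQ_unique by simp
    then have "2 *\<^sub>R Y x = 2 *\<^sub>R ((1/2) *\<^sub>R (A x + Y (Y x)))"
      by (rule arg_cong)
    then show ?thesis
      by simp
  qed
  define S where "S x = sqrt c *\<^sub>R (x - Y x)" for x
  have linS: "clinear_on UNIV S"
    using linY unfolding clinear_on_def S_def
    by (simp add: scaleR_eq_scaleC scaleC_add_right scaleC_scaleC mult.commute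
        complex_vector.scale_right_diff_distrib)
  have "S (S x) = c *\<^sub>R (x - 2 *\<^sub>R Y x + Y (Y x))" for x
  proof -
    have "Y (S x) = sqrt c *\<^sub>R (Y x - Y (Y x))"
      by (simp add: S_def clinear_on_scaleR[OF linY] clinear_on_diff[OF linY])
    then have "S (S x) = sqrt c *\<^sub>R (sqrt c *\<^sub>R (x - Y x) - sqrt c *\<^sub>R (Y x - Y (Y x)))"
      by (simp add: S_def)
    also have "\<dots> = (sqrt c * sqrt c) *\<^sub>R (x - Y x - (Y x - Y (Y x)))"
      by (simp only: scaleR_scaleR scaleR_right_diff_distrib)
    also have "\<dots> = c *\<^sub>R (x - 2 *\<^sub>R Y x + Y (Y x))"
      using c(1) by (simp add: scaleR_2 algebra_simps)
    finally show ?thesis .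
  qed
  then have SS: "S (S x) = B x" for x
    using c(1) by (simp add: fix_pt A_def)
  have "nonneg_map S"
    unfolding nonneg_map_def
  proof (intro conjI allI exI)
    show "norm (S x) \<le> (sqrt c * 2) * norm x" for x
    proof -
      have "norm (x - Y x) \<le> 2 * norm x"
        using norm_triangle_ineq4[of x "Y x"] normY[of x] by simp
      then show ?thesis
        using c(1) by (simp add: S_def)
    qed
    show "cinner (S x) x \<in> \<real>\<^sub>\<ge>\<^sub>0" for x
    proof -
      have "cinner (Y x) x = cnj (cinner (Y x) x)"
        using symY[of x x] cinner_commute[of x "Y x"] by simp
      then have "Im (cinner (Y x) x) = 0"
        by (simp add: complex_eq_iff)
      moreover have "inner (Y x) x \<le> norm x * norm x"
        using norm_cauchy_schwarz[of "Y x" x] mult_right_mono[OF normY[of x] norm_ge_zero[of x]]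
        by simp
      ultimately show ?thesis
        using c(1) by (simp add: complex_nonneg_Reals_iff S_def cinner_expand Re_cinner cinner_self
            power2_eq_square flip: power2_norm_eq_inner)
    qed
  qed (rule linS)
  moreover have "P (S x) = S (P x)" if P: "nonneg_map P" and PB: "\<And>x. P (B x) = B (P x)" for P x
  proof -
    note linP = nonneg_map_linear[OF P]
    have PA: "A (P x) = P (A x)" for x
      by (simp add: A_def clinear_on_diff[OF linP] clinear_on_scaleR[OF linP] PB)
    obtain d where d: "d > 0" "\<And>x. norm (P x) \<le> d * norm x"
      using nonneg_map_bound P by blast
    have "(\<lambda>n. P (sqrt_iter A n x)) \<longlonglongrightarrow> P (Y x)"
    proof (rule LIM_zero_cancel, rule Lim_null_comparison)
      show "\<forall>\<^sub>F n in sequentially. norm (P (sqrt_iter A n x) - P (Y x)) \<le> d * norm (sqrt_iter A n x - Y x)"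
        using d(2) by (simp flip: clinear_on_diff[OF linP])
      show "(\<lambda>n. d * norm (sqrt_iter A n x - Y x)) \<longlonglongrightarrow> 0"
        using Y LIM_zero tendsto_norm_zero tendsto_mult_right_zero by blast
    qed
    then have "P (Y x) = Y (P x)"
      using LIMSEQ_unique Y[of "P x"] by (simp add: sqrt_iter_commute[of A P, OF PA linP])
    then show ?thesis
      by (simp add: S_def clinear_on_diff[OF linP] clinear_on_scaleR[OF linP])
  qed
  ultimately show thesis
    using that SS by blast
qed

text \<open>
  For commuting roots \<open>(S + R) (S - R) = S\<^sup>2 - R\<^sup>2 = 0\<close>. So the forms of \<open>S\<close> and \<open>R\<close> add up to \<open>0\<close> on the
  range of \<open>S - R\<close>, both operators vanish there, and the symmetric operator \<open>S - R\<close> has square \<open>0\<close>.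
\<close>

lemma nonneg_map_sqrt_unique:
  assumes S: "nonneg_map S" and R: "nonneg_map R"
    and eq: "\<And>x. S (S x) = R (R x)" and comm: "\<And>x. R (S x) = S (R x)"
  shows "R = S"
proof
  fix x
  note linS = nonneg_map_linear[OF S] and linR = nonneg_map_linear[OF R]
  define y where "y = S x - R x"
  have "S y + R y = 0"
    by (simp add: y_def clinear_on_diff[OF linS] clinear_on_diff[OF linR] eq comm)
  then have "inner (S y) y + inner (R y) y = 0"
    by (simp flip: inner_add_left)
  then have "inner (S y) y = 0" "inner (R y) y = 0"
    using nonneg_map_inner[OF S, of y] nonneg_map_inner[OF R, of y] by linarith+
  then have "S y = 0" "R y = 0"
    using nonneg_map_eq_0_if_form_0 S R by blast+
  then have "cinner y y = 0"
    by (metis cinner_diff_right cinner_zero_left diff_self nonneg_map_symmetric[OF S]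
        nonneg_map_symmetric[OF R] y_def)
  then show "R x = S x"
    by (simp add: cinner_self_eq_0 y_def)
qed

lemma op_sqrt_Some:
  fixes B :: "'a::complex_hilbert \<Rightarrow> 'a"
  assumes B: "nonneg_map B"
  obtains S where "nonneg_map S" "\<And>x. S (S x) = B x"
    "op_sqrt (\<lambda>x. Some (B x)) = (\<lambda>x. Some (S x))"
proof -
  obtain S where S: "nonneg_map S" "\<And>x. S (S x) = B x"
    and comm: "\<And>P x. nonneg_map P \<Longrightarrow> (\<And>x. P (B x) = B (P x)) \<Longrightarrow> P (S x) = S (P x)"
    using nonneg_map_sqrt_exists[OF B] by blast
  have "op_sqrt (\<lambda>x. Some (B x)) = (\<lambda>x. Some (S x))"
    unfolding op_sqrt_def
  proof (rule the_equality)
    show "bounded_nonneg (\<lambda>x. Some (S x)) \<and> (\<lambda>x. Some (S x)) \<circ>\<^sub>m (\<lambda>x. Some (S x)) = (\<lambda>x. Some (B x))"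
      using S by (simp add: bounded_nonneg_Some map_comp_def)
    fix R'
    assume R': "bounded_nonneg R' \<and> R' \<circ>\<^sub>m R' = (\<lambda>x. Some (B x))"
    define R where "R x = R' \<cdot> x" for x
    have R'_eq: "R' = (\<lambda>x. Some (R x))"
      unfolding R_def using R' by (intro total_map_eq_Some) (simp add: bounded_nonneg_def)
    have R: "nonneg_map R"
      using R' unfolding R'_eq bounded_nonneg_Some by simp
    have RR: "R (R x) = B x" for x
      using R' unfolding R'_eq by (auto simp: map_comp_def dest: fun_cong)
    have "R = S"
      using nonneg_map_sqrt_unique[OF S(1) R] S(2) RR comm[OF R] by metis
    then show "R' = (\<lambda>x. Some (S x))"
      by (simp add: R'_eq)
  qed
  then show thesis
    using that S by blast
qed

text \<open>
  The range depends on \<open>S\<close> only through \<open>norm (S h)\<close>, that is, through the quadratic form of the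
  square of \<open>S\<close>.
\<close>

lemma range_symmetric_iff:
  fixes S :: "'a::complex_hilbert \<Rightarrow> 'a"
  assumes lin: "clinear_on UNIV S" and sym: "\<And>x y. cinner (S x) y = cinner x (S y)"
  shows "g \<in> range S \<longleftrightarrow> (\<exists>C. \<forall>h. cmod (cinner h g) \<le> C * norm (S h))"
proof
  assume "g \<in> range S"
  then obtain k where "g = S k"
    by blast
  then have "cmod (cinner h g) \<le> norm k * norm (S h)" for h
    using cinner_cauchy_schwarz[of "S h" k] sym[of h k] by (simp add: mult.commute)
  then show "\<exists>C. \<forall>h. cmod (cinner h g) \<le> C * norm (S h)"
    by blast
next
  assume "\<exists>C. \<forall>h. cmod (cinner h g) \<le> C * norm (S h)"
  then obtain C where C: "\<And>h. cmod (cinner h g) \<le> C * norm (S h)"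
    by blast
  obtain w where "\<And>h. h \<in> UNIV \<Longrightarrow> cinner h g = cinner (S h) w"
    using dominated_functional_repr[OF clinear_on_id[OF complex_vector.subspace_UNIV] lin] C
    by blast
  then have "g = S w"
    by (intro cinner_ext) (simp add: sym)
  then show "g \<in> range S"
    by blast
qed

section \<open>Maximal dissipative operators\<close>

lemma op_adjoint_eq_Some_iff:
  fixes T :: "'a::complex_inner \<rightharpoonup> 'b::complex_inner"
  assumes "closure (dom T) = UNIV"
  shows "op_adjoint T g = Some h \<longleftrightarrow> (\<forall>f\<in>dom T. cinner (T \<cdot> f) g = cinner f h)"
proof -
  have unique: "h = h'" if "\<forall>f\<in>dom T. cinner (T \<cdot> f) g = cinner f h"
    "\<forall>f\<in>dom T. cinner (T \<cdot> f) g = cinner f h'" for h h'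
  proof -
    have "h - h' = 0"
      by (rule cinner_eq_0_if_orth_dense[OF assms]) (use that in \<open>simp add: cinner_diff_right\<close>)
    then show ?thesis
      by simp
  qed
  show ?thesis
  proof
    assume "op_adjoint T g = Some h"
    then have ex: "\<exists>!h. \<forall>f\<in>dom T. cinner (T \<cdot> f) g = cinner f h"
      and h: "h = (THE h. \<forall>f\<in>dom T. cinner (T \<cdot> f) g = cinner f h)"
      by (auto simp: op_adjoint_def split: if_splits)
    show "\<forall>f\<in>dom T. cinner (T \<cdot> f) g = cinner f h"
      unfolding h by (rule theI'[OF ex])
  next
    assume h: "\<forall>f\<in>dom T. cinner (T \<cdot> f) g = cinner f h"
    then have "\<exists>!h. \<forall>f\<in>dom T. cinner (T \<cdot> f) g = cinner f h"
      using unique by blast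
    moreover have "(THE h. \<forall>f\<in>dom T. cinner (T \<cdot> f) g = cinner f h) = h"
    proof (rule the_equality)
      show "h' = h" if "\<forall>f\<in>dom T. cinner (T \<cdot> f) g = cinner f h'" for h'
        using that h by (rule unique)
    qed (rule h)
    ultimately show "op_adjoint T g = Some h"
      by (simp add: op_adjoint_def)
  qed
qed

lemma maximal_dissipative_linear: "maximal_dissipative T \<Longrightarrow> clinear_on (dom T) (\<lambda>f. T \<cdot> f)"
  by (simp add: maximal_dissipative_def dissipative_def linear_op_clinear_on)

text \<open>
  Maximality in the form in which it is used. If \<open>v\<close> were outside the domain, \<open>f + c v \<mapsto> T f + c w\<close>
  would be a proper dissipative extension. If \<open>v\<close> is inside, replacing \<open>f\<close> by \<open>f - c v\<close> in the
  hypothesis shows that \<open>w - T v\<close> is orthogonal to the dense domain, since \<open>c\<close> is arbitrary.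
  The lemma thus yields closability and closedness of \<open>T\<close> as well as the fullness of ranges.
\<close>

lemma maximal_dissipative_extend_by_vector:
  fixes T :: "'a::complex_inner \<rightharpoonup> 'a"
  assumes T: "maximal_dissipative T"
    and pos: "\<And>f c. f \<in> dom T \<Longrightarrow> Im (cinner (T \<cdot> f + c *\<^sub>C w) (f + c *\<^sub>C v)) \<ge> 0"
  shows "T v = Some w"
proof -
  note lin = maximal_dissipative_linear[OF T]
  note sub = clinear_on_subspace[OF lin]
  have "v \<in> dom T"
  proof (rule ccontr)
    assume v: "v \<notin> dom T"
    have uniq: "c = c' \<and> f = f'"
      if "f \<in> dom T" "f' \<in> dom T" "f + c *\<^sub>C v = f' + c' *\<^sub>C v" for f f' c c'
    proof -
      have diff: "(c - c') *\<^sub>C v = f' - f"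
        using that(3) by (simp add: complex_vector.scale_left_diff_distrib algebra_simps)
      have "c = c'"
      proof (rule ccontr)
        assume "c \<noteq> c'"
        then have "v = inverse (c - c') *\<^sub>C (f' - f)"
          by (simp flip: diff add: scaleC_scaleC scaleC_one)
        then show False
          using v sub that complex_vector.subspace_scale complex_vector.subspace_diff by metis
      qed
      then show ?thesis
        using that by simp
    qed
    define S where "S x = (if \<exists>f\<in>dom T. \<exists>c. x = f + c *\<^sub>C v
      then Some (THE y. \<exists>f\<in>dom T. \<exists>c. x = f + c *\<^sub>C v \<and> y = T \<cdot> f + c *\<^sub>C w) else None)" for x
    have S: "S (f + c *\<^sub>C v) = Some (T \<cdot> f + c *\<^sub>C w)" if "f \<in> dom T" for f c
    proof -
      have "(THE y. \<exists>f'\<in>dom T. \<exists>c'. f + c *\<^sub>C v = f' + c' *\<^sub>C v \<and> y = T \<cdot> f' + c' *\<^sub>C w)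
          = T \<cdot> f + c *\<^sub>C w"
        by (rule the_equality) (use that uniq in blast)+
      then show ?thesis
        using that unfolding S_def by auto
    qed
    have domS: "x \<in> dom S \<longleftrightarrow> (\<exists>f\<in>dom T. \<exists>c. x = f + c *\<^sub>C v)" for x
      by (auto simp: S_def dom_def)
    have add_eq: "(f + c *\<^sub>C v) + (f' + c' *\<^sub>C v) = (f + f') + (c + c') *\<^sub>C v" for f f' c c'
      by (simp add: scaleC_add_left algebra_simps)
    have scale_eq: "a *\<^sub>C (f + c *\<^sub>C v) = a *\<^sub>C f + (a * c) *\<^sub>C v" for a f c
      by (simp add: scaleC_add_right scaleC_scaleC)
    have "clinear_on (dom S) (\<lambda>f. S \<cdot> f)"
      unfolding clinear_on_def
    proof (intro conjI ballI allI)
      show "complex_vector.subspace (dom S)"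
      proof (rule complex_vector.subspaceI)
        have "0 = 0 + 0 *\<^sub>C v"
          by simp
        then show "0 \<in> dom S"
          unfolding domS using complex_vector.subspace_0[OF sub] by blast
        show "x + y \<in> dom S" if "x \<in> dom S" "y \<in> dom S" for x y
          using that unfolding domS by (metis add_eq sub complex_vector.subspace_add)
        show "a *\<^sub>C x \<in> dom S" if "x \<in> dom S" for a x
          using that unfolding domS by (metis scale_eq sub complex_vector.subspace_scale)
      qed
    next
      fix x y
      assume "x \<in> dom S" "y \<in> dom S"
      then obtain f c f' c' where xy: "f \<in> dom T" "f' \<in> dom T" "x = f + c *\<^sub>C v" "y = f' + c' *\<^sub>C v"
        unfolding domS by blast
      have "f + f' \<in> dom T"
        using sub xy complex_vector.subspace_add by blast
      then show "S \<cdot> (x + y) = S \<cdot> x + S \<cdot> y"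
        using xy by (simp add: add_eq S clinear_on_add[OF lin]) (rule scaleC_add_left)
    next
      fix a x
      assume "x \<in> dom S"
      then obtain f c where x: "f \<in> dom T" "x = f + c *\<^sub>C v"
        unfolding domS by blast
      have "a *\<^sub>C f \<in> dom T"
        using sub x complex_vector.subspace_scale by blast
      then show "S \<cdot> (a *\<^sub>C x) = a *\<^sub>C (S \<cdot> x)"
        unfolding x(2) scale_eq using x
        by (simp add: S clinear_on_scaleC[OF lin] scaleC_add_right scaleC_scaleC)
    qed
    moreover have "im_form S x \<ge> 0" if x: "x \<in> dom S" for x
    proof -
      obtain f c where "f \<in> dom T" "x = f + c *\<^sub>C v"
        using x unfolding domS by blast
      then show ?thesis
        using pos[of f c] S[of f c] by (simp add: im_form_def)
    qed
    ultimately have "dissipative S"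
      by (simp add: dissipative_def linear_op_clinear_on)
    moreover have "T \<subseteq>\<^sub>m S"
      unfolding map_le_def
    proof
      fix f
      assume "f \<in> dom T"
      then show "T f = S f"
        using S[of f 0] by auto
    qed
    ultimately have "S = T"
      using T by (simp add: maximal_dissipative_def)
    moreover have "v \<in> dom S"
      unfolding domS using complex_vector.subspace_0[OF sub] scaleC_one by (metis add_0)
    ultimately show False
      using v by simp
  qed
  have "cinner f (w - T \<cdot> v) = 0" if f: "f \<in> dom T" for f
  proof -
    define d where "d = cinner (w - T \<cdot> v) f"
    have lower: "Im (cinner (T \<cdot> f) f) + Im (c * d) \<ge> 0" for c
    proof -
      have cv: "c *\<^sub>C v \<in> dom T"
        using sub \<open>v \<in> dom T\<close> complex_vector.subspace_scale by blast
      then have "f - c *\<^sub>C v \<in> dom T"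
        using sub f complex_vector.subspace_diff by blast
      from pos[OF this, of c] show ?thesis
        using f cv \<open>v \<in> dom T\<close>
        by (simp add: d_def clinear_on_diff[OF lin] clinear_on_scaleC[OF lin] cinner_expand
            right_diff_distrib)
    qed
    \<comment> \<open>a linear function of a complex scalar that is bounded below vanishes: run along \<open>c = - \<i> t cnj d\<close>\<close>
    have le: "t * (cmod d)\<^sup>2 \<le> im_form T f" for t
    proof -
      have "Im ((- \<i> * of_real t * cnj d) * d) = - (t * (cmod d)\<^sup>2)"
        by (simp add: cmod_power2) (simp add: power2_eq_square algebra_simps)
      then show ?thesis
        using lower[of "- \<i> * of_real t * cnj d"] by (simp add: im_form_def)
    qed
    have "d = 0"
    proof (rule ccontr)
      assume "d \<noteq> 0"
      then have "(cmod d)\<^sup>2 \<le> 0"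
        using le[of "im_form T f / (cmod d)\<^sup>2 + 1"] by (simp add: distrib_right)
      then show False
        using \<open>d \<noteq> 0\<close> by simp
    qed
    then show ?thesis
      by (metis cinner_commute complex_cnj_zero d_def)
  qed
  then have "w - T \<cdot> v = 0"
    using T by (intro cinner_eq_0_if_orth_dense[of "dom T"]) (simp_all add: maximal_dissipative_def)
  then show ?thesis
    using \<open>v \<in> dom T\<close> by auto
qed

lemma Im_cinner_shift:
  "Im (cinner (T \<cdot> f - a *\<^sub>C f) f) = im_form T f - Im a * (norm f)\<^sup>2"
  by (simp add: cinner_expand cinner_self im_form_def)

lemma dissipative_lower_bound:
  assumes "dissipative T" "f \<in> dom T"
  shows "- Im a * norm f \<le> norm (T \<cdot> f - a *\<^sub>C f)"
proof -
  have "- Im a * norm f * norm f \<le> Im (cinner (T \<cdot> f - a *\<^sub>C f) f)"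
    using assms by (simp add: Im_cinner_shift dissipative_def power2_eq_square mult.assoc)
  also have "\<dots> \<le> norm (T \<cdot> f - a *\<^sub>C f) * norm f"
    using abs_Im_le_cmod[of "cinner (T \<cdot> f - a *\<^sub>C f) f"]
      cinner_cauchy_schwarz[of "T \<cdot> f - a *\<^sub>C f" f] by linarith
  finally have "- Im a * norm f * norm f \<le> norm (T \<cdot> f - a *\<^sub>C f) * norm f" .
  then show ?thesis
    by (cases "f = 0") (simp, rule mult_right_le_imp_le, auto)
qed

lemma clinear_on_shift:
  assumes "clinear_on (dom T) (\<lambda>f. T \<cdot> f)"
  shows "clinear_on (dom T) (\<lambda>f. T \<cdot> f - a *\<^sub>C f)"
  using assms by (simp add: clinear_on_def scaleC_add_right scaleC_scaleC
      complex_vector.scale_right_diff_distrib mult.commute)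

lemma clinear_on_image_subspace:
  assumes "clinear_on N f"
  shows "complex_vector.subspace (f ` N)"
proof (rule complex_vector.subspaceI)
  note sub = clinear_on_subspace[OF assms]
  have "f 0 = f 0 + f 0"
    using clinear_on_add[OF assms] complex_vector.subspace_0[OF sub] by (metis add_0)
  then show "0 \<in> f ` N"
    using complex_vector.subspace_0[OF sub] by (metis add_cancel_right_right image_eqI)
  show "x + y \<in> f ` N" if xy: "x \<in> f ` N" "y \<in> f ` N" for x y
  proof -
    obtain p q where "p \<in> N" "q \<in> N" "x = f p" "y = f q"
      using xy by blast
    then show ?thesis
      using clinear_on_add[OF assms] complex_vector.subspace_add[OF sub] by (metis imageI)
  qed
  show "c *\<^sub>C x \<in> f ` N" if x: "x \<in> f ` N" for c x
  proof -
    obtain p where "p \<in> N" "x = f p"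
      using x by blast
    then show ?thesis
      using clinear_on_scaleC[OF assms] complex_vector.subspace_scale[OF sub] by (metis imageI)
  qed
qed

text \<open>
  The extension lemma is applied twice. A vector \<open>n\<close> orthogonal to the range of \<open>T - a\<close> could be
  adjoined to \<open>T\<close> with value \<open>cnj a n\<close>, which forces \<open>n = 0\<close>, so the range is dense. The lower bound
  for \<open>T - a\<close> turns convergent images into convergent preimages, and the limit of the preimages can
  be adjoined with the limit of their values under \<open>T\<close>, so the range is closed.
\<close>

lemma maximal_dissipative_shift_surj:
  fixes T :: "'a::complex_hilbert \<rightharpoonup> 'a"
  assumes T: "maximal_dissipative T" and a: "Im a < 0"
  obtains f where "f \<in> dom T" "T \<cdot> f - a *\<^sub>C f = h"
proof -
  note lin = maximal_dissipative_linear[OF T]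
  note sub = clinear_on_subspace[OF lin]
  define K where "K f = T \<cdot> f - a *\<^sub>C f" for f
  have linK: "clinear_on (dom T) K"
    unfolding K_def by (rule clinear_on_shift[OF lin])
  have diss: "dissipative T" and pos: "\<And>f. f \<in> dom T \<Longrightarrow> Im (cinner (T \<cdot> f) f) \<ge> 0"
    using T by (simp_all add: maximal_dissipative_def dissipative_def im_form_def)
  have "closure (K ` dom T) = UNIV"
  proof (rule ccontr)
    assume "closure (K ` dom T) \<noteq> UNIV"
    then obtain n where n: "n \<noteq> 0" "\<And>f. f \<in> dom T \<Longrightarrow> cinner (K f) n = 0"
      using nondense_subspace_orth[OF clinear_on_image_subspace[OF linK]] by (metis imageI)
    have adj: "cinner (T \<cdot> f) n = a * cinner f n" if "f \<in> dom T" for f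
      using n(2)[OF that] by (simp add: K_def cinner_expand)
    have "T n = Some (cnj a *\<^sub>C n)"
    proof (rule maximal_dissipative_extend_by_vector[OF T])
      fix f c
      assume f: "f \<in> dom T"
      \<comment> \<open>the two mixed terms are complex conjugates of each other, so only the diagonal contributes\<close>
      define X where "X = cnj c * (a * cinner f n)"
      have "c * cnj c = of_real ((cmod c)\<^sup>2)"
        by (simp only: complex_norm_square)
      moreover have "cinner (T \<cdot> f + c *\<^sub>C cnj a *\<^sub>C n) (f + c *\<^sub>C n) = cinner (T \<cdot> f) f
          + (X + cnj X) + (c * cnj c) * cnj a * cinner n n"
        using adj[OF f] cinner_commute[of n f] by (simp add: X_def cinner_expand algebra_simps)
      ultimately have "Im (cinner (T \<cdot> f + c *\<^sub>C cnj a *\<^sub>C n) (f + c *\<^sub>C n))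
          = Im (cinner (T \<cdot> f) f) - (cmod c)\<^sup>2 * Im a * (norm n)\<^sup>2"
        by (simp add: cinner_self del: of_real_power)
      then show "Im (cinner (T \<cdot> f + c *\<^sub>C cnj a *\<^sub>C n) (f + c *\<^sub>C n)) \<ge> 0"
        using pos[OF f] mult_nonpos_nonneg[OF mult_nonneg_nonpos, of "(cmod c)\<^sup>2" "Im a" "(norm n)\<^sup>2"] a
        by simp
    qed
    then have "n \<in> dom T" "T \<cdot> n = cnj a *\<^sub>C n"
      by auto
    then have "(cnj a - a) * cinner n n = 0"
      using adj[of n] by (simp add: cinner_expand algebra_simps)
    moreover have "cnj a - a \<noteq> 0"
      using a by (auto simp: complex_eq_iff)
    ultimately show False
      using n(1) by (simp add: cinner_self_eq_0)
  qed
  then obtain G where G: "\<And>k. G k \<in> K ` dom T" "G \<longlonglongrightarrow> h"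
    using closure_sequential[of h "K ` dom T"] by auto
  have "\<exists>F. \<forall>k. F k \<in> dom T \<and> G k = K (F k)"
    by (intro choice allI) (use G(1) in blast)
  then obtain F where F: "\<And>k. F k \<in> dom T" "\<And>k. G k = K (F k)"
    by blast
  have KF: "(\<lambda>k. K (F k)) \<longlonglongrightarrow> h"
    using G(2) by (simp flip: F(2))
  have "Cauchy F"
  proof (rule CauchyI)
    fix e :: real
    assume "e > 0"
    then have "- Im a * e > 0"
      using a by (simp add: mult_neg_pos)
    moreover have "Cauchy (\<lambda>k. K (F k))"
      using KF LIMSEQ_imp_Cauchy by blast
    ultimately obtain M where M: "\<And>m n. m \<ge> M \<Longrightarrow> n \<ge> M \<Longrightarrow> norm (K (F m) - K (F n)) < - Im a * e"
      using CauchyD by blast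
    have "norm (F m - F n) < e" if "m \<ge> M" "n \<ge> M" for m n
    proof -
      have "F m - F n \<in> dom T"
        using sub F(1) complex_vector.subspace_diff by blast
      then have "- Im a * norm (F m - F n) \<le> norm (K (F m - F n))"
        unfolding K_def by (rule dissipative_lower_bound[OF diss])
      also have "\<dots> < - Im a * e"
        using M[OF that] F(1) by (simp add: clinear_on_diff[OF linK])
      finally show ?thesis
        using a by simp
    qed
    then show "\<exists>M. \<forall>m\<ge>M. \<forall>n\<ge>M. norm (F m - F n) < e"
      by blast
  qed
  then obtain f where f: "F \<longlonglongrightarrow> f"
    using Cauchy_convergent_iff convergent_def by blast
  have TF: "(\<lambda>k. T \<cdot> F k) \<longlonglongrightarrow> h + a *\<^sub>C f"
    using tendsto_add[OF KF tendsto_scaleC[OF f, of a]] by (simp add: K_def)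
  have "T f = Some (h + a *\<^sub>C f)"
  proof (rule maximal_dissipative_extend_by_vector[OF T])
    fix g c
    assume g: "g \<in> dom T"
    have "(\<lambda>k. Im (cinner (T \<cdot> g + c *\<^sub>C (T \<cdot> F k)) (g + c *\<^sub>C F k)))
        \<longlonglongrightarrow> Im (cinner (T \<cdot> g + c *\<^sub>C (h + a *\<^sub>C f)) (g + c *\<^sub>C f))"
      by (intro tendsto_Im tendsto_cinner tendsto_add tendsto_const tendsto_scaleC TF f)
    moreover have "Im (cinner (T \<cdot> g + c *\<^sub>C (T \<cdot> F k)) (g + c *\<^sub>C F k)) \<ge> 0" for k
    proof -
      have cF: "c *\<^sub>C F k \<in> dom T"
        using sub F(1) complex_vector.subspace_scale by blast
      then have "g + c *\<^sub>C F k \<in> dom T"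
        using sub g complex_vector.subspace_add by blast
      from pos[OF this] show ?thesis
        using g cF F(1) by (simp add: clinear_on_add[OF lin] clinear_on_scaleC[OF lin])
    qed
    ultimately show "Im (cinner (T \<cdot> g + c *\<^sub>C (h + a *\<^sub>C f)) (g + c *\<^sub>C f)) \<ge> 0"
      by (intro LIMSEQ_le_const) auto
  qed
  then show thesis
    by (intro that[of f]) auto
qed


section \<open>The range space of the imaginary part\<close>

lemma boundary_pair_im_form:
  assumes "boundary_pair T \<Gamma>" "f \<in> dom T"
  shows "im_form T f = (norm (\<Gamma> \<cdot> f))\<^sup>2"
proof -
  have "cinner (T \<cdot> f) f - cinner f (T \<cdot> f) = 2 * \<i> * cinner (\<Gamma> \<cdot> f) (\<Gamma> \<cdot> f)"
    using assms by (simp add: boundary_pair_def)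
  then have "Im (cinner (T \<cdot> f) f) - Im (cinner f (T \<cdot> f)) = 2 * (norm (\<Gamma> \<cdot> f))\<^sup>2"
    by (simp add: cinner_self complex_eq_iff)
  moreover have "Im (cinner f (T \<cdot> f)) = - Im (cinner (T \<cdot> f) f)"
    using arg_cong[OF cinner_commute[of f "T \<cdot> f"], of Im] by simp
  ultimately show ?thesis
    by (simp add: im_form_def)
qed

lemma ran_Some: "ran (\<lambda>x. Some (S x)) = range S"
  by (auto simp: ran_def)

text \<open>
  The shift contributes \<open>a * cinner f g\<close>, which is itself dominated by \<open>norm f\<close>. This is why the
  spectral parameter drops out of the description of \<open>L_space T\<close>.
\<close>

lemma shift_dominated_iff:
  fixes T :: "'h::complex_inner \<rightharpoonup> 'h" and \<Gamma> :: "'h \<rightharpoonup> 'e::complex_inner"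
  shows "(\<exists>C. \<forall>f\<in>dom T. cmod (cinner (T \<cdot> f - a *\<^sub>C f) g) \<le> C * norm (f, \<Gamma> \<cdot> f))
    \<longleftrightarrow> (\<exists>C. \<forall>f\<in>dom T. cmod (cinner (T \<cdot> f) g) \<le> C * norm (f, \<Gamma> \<cdot> f))"
proof -
  have diff: "cmod (cinner (T \<cdot> f) g - cinner (T \<cdot> f - a *\<^sub>C f) g) \<le> (cmod a * norm g) * norm (f, \<Gamma> \<cdot> f)"
    for f
  proof -
    have "cmod (cinner (T \<cdot> f) g - cinner (T \<cdot> f - a *\<^sub>C f) g) = cmod a * cmod (cinner f g)"
      by (simp add: cinner_expand norm_mult)
    also have "\<dots> \<le> cmod a * (norm f * norm g)"
      by (intro mult_left_mono cinner_cauchy_schwarz) simp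
    also have "\<dots> \<le> cmod a * (norm (f, \<Gamma> \<cdot> f) * norm g)"
      using norm_fst_le[of f "\<Gamma> \<cdot> f"] by (intro mult_left_mono mult_right_mono) auto
    finally show ?thesis
      by (simp add: mult_ac)
  qed
  have le: "cmod y \<le> (C + D) * t" if "cmod x \<le> C * t" "cmod (y - x) \<le> D * t" for x y C D and t :: real
    using that norm_triangle_sub[of y x] by (simp add: distrib_right)
  show ?thesis
  proof
    assume "\<exists>C. \<forall>f\<in>dom T. cmod (cinner (T \<cdot> f - a *\<^sub>C f) g) \<le> C * norm (f, \<Gamma> \<cdot> f)"
    then show "\<exists>C. \<forall>f\<in>dom T. cmod (cinner (T \<cdot> f) g) \<le> C * norm (f, \<Gamma> \<cdot> f)"
      using le[OF _ diff] by blast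
  next
    assume "\<exists>C. \<forall>f\<in>dom T. cmod (cinner (T \<cdot> f) g) \<le> C * norm (f, \<Gamma> \<cdot> f)"
    then show "\<exists>C. \<forall>f\<in>dom T. cmod (cinner (T \<cdot> f - a *\<^sub>C f) g) \<le> C * norm (f, \<Gamma> \<cdot> f)"
      using le[OF _ diff[unfolded norm_minus_commute[of "cinner (T \<cdot> _) g"]]] by blast
  qed
qed

text \<open>
  Let \<open>R\<close> be the inverse of \<open>T + \<i>\<close>. Its adjoint \<open>Q\<close> is the resolvent in the definition of
  \<open>L_space T\<close>, and for \<open>u = R h\<close> the form of the imaginary part of \<open>Q\<close> at \<open>h\<close> is \<open>Im (cinner h u)\<close>, that is
  \<open>im_form T u + (norm u)\<^sup>2 = (norm (\<Gamma> u))\<^sup>2 + (norm u)\<^sup>2\<close>. Hence the square root \<open>S\<close> satisfies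
  \<open>norm (S h) = norm (u, \<Gamma> u)\<close>, and \<open>range_symmetric_iff\<close> applies.
\<close>

lemma L_space_eq:
  fixes T :: "'h::complex_hilbert \<rightharpoonup> 'h" and \<Gamma> :: "'h \<rightharpoonup> 'e::complex_hilbert"
  assumes bp: "boundary_pair T \<Gamma>"
  shows "L_space T = {g. \<exists>C. \<forall>f\<in>dom T. cmod (cinner (T \<cdot> f) g) \<le> C * norm (f, \<Gamma> \<cdot> f)}"
proof -
  have T: "maximal_dissipative T"
    using bp by (simp add: boundary_pair_def)
  then have diss: "dissipative T" and dense: "closure (dom T) = UNIV"
    by (simp_all add: maximal_dissipative_def)
  note lin = maximal_dissipative_linear[OF T]
  note sub = clinear_on_subspace[OF lin]
  define K where "K f = T \<cdot> f - (- \<i>) *\<^sub>C f" for f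
  have linK: "clinear_on (dom T) K"
    unfolding K_def by (rule clinear_on_shift[OF lin])
  have lower: "norm f \<le> norm (K f)" if "f \<in> dom T" for f
    using dissipative_lower_bound[OF diss that, of "- \<i>"] by (simp add: K_def)
  have "\<exists>f. f \<in> dom T \<and> K f = h" for h
    unfolding K_def by (rule maximal_dissipative_shift_surj[OF T, of "- \<i>" h]) auto
  then have "\<exists>R. \<forall>h. R h \<in> dom T \<and> K (R h) = h"
    by (intro choice) simp
  then obtain R where R: "\<And>h. R h \<in> dom T" "\<And>h. K (R h) = h"
    by blast
  have inj: "f = g" if "f \<in> dom T" "g \<in> dom T" "K f = K g" for f g
  proof -
    have "norm (f - g) \<le> norm (K (f - g))"
      using that sub complex_vector.subspace_diff by (intro lower) blast
    then show ?thesis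
      using that by (simp add: clinear_on_diff[OF linK])
  qed
  have RK: "R (K f) = f" if "f \<in> dom T" for f
    using inj R that by blast
  have linR: "clinear_on UNIV R"
    unfolding clinear_on_def
  proof (intro conjI ballI allI)
    show "R (x + y) = R x + R y" for x y
    proof (rule inj)
      show "R x + R y \<in> dom T"
        by (rule complex_vector.subspace_add[OF sub R(1) R(1)])
    qed (simp_all add: R clinear_on_add[OF linK])
    show "R (c *\<^sub>C x) = c *\<^sub>C R x" for c x
    proof (rule inj)
      show "c *\<^sub>C R x \<in> dom T"
        by (rule complex_vector.subspace_scale[OF sub R(1)])
    qed (simp_all add: R clinear_on_scaleC[OF linK])
  qed (rule complex_vector.subspace_UNIV)
  have R_le: "norm (R h) \<le> norm h" for h
    using lower[OF R(1), of h] R(2) by simp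
  have "\<exists>q. \<forall>h. cinner (R h) g = cinner h q" for g
  proof -
    have "cmod (cinner (R h) g) \<le> norm g * norm h" for h
      using cinner_cauchy_schwarz[of "R h" g] mult_right_mono[OF R_le[of h] norm_ge_zero[of g]]
      by (simp add: mult.commute)
    then show ?thesis
      using dominated_functional_repr[OF linR clinear_on_id[OF complex_vector.subspace_UNIV]]
      by (metis UNIV_I)
  qed
  then obtain Q where Q: "\<And>h g. cinner (R h) g = cinner h (Q g)"
    by metis
  have Q': "cinner (Q g) h = cinner g (R h)" for g h
    using Q[of h g] by (metis cinner_commute)
  have linQ: "clinear_on UNIV Q"
    unfolding clinear_on_def
  proof (intro conjI ballI allI)
    show "Q (x + y) = Q x + Q y" for x y
      by (rule cinner_ext) (simp add: cinner_expand flip: Q)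
    show "Q (c *\<^sub>C x) = c *\<^sub>C Q x" for c x
      by (rule cinner_ext) (simp add: cinner_expand flip: Q)
  qed (rule complex_vector.subspace_UNIV)
  have Q_le: "norm (Q g) \<le> norm g" for g
  proof -
    have "(norm (Q g))\<^sup>2 = cmod (cinner (R (Q g)) g)"
      by (simp add: Q cinner_self norm_power)
    also have "\<dots> \<le> norm (Q g) * norm g"
      using cinner_cauchy_schwarz[of "R (Q g)" g] mult_right_mono[OF R_le[of "Q g"] norm_ge_zero[of g]]
      by linarith
    finally show ?thesis
      by (cases "Q g = 0") (simp_all add: power2_eq_square)
  qed
  have "op_diff (op_adjoint T) (op_scale \<i> Some) f = Some g \<longleftrightarrow> f = Q g" for f g
  proof -
    have "op_diff (op_adjoint T) (op_scale \<i> Some) f = Some g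
        \<longleftrightarrow> op_adjoint T f = Some (g + \<i> *\<^sub>C f)"
      by (auto simp: op_diff_def op_scale_def dom_def)
    also have "\<dots> \<longleftrightarrow> (\<forall>u\<in>dom T. cinner (K u) f = cinner u g)"
      unfolding op_adjoint_eq_Some_iff[OF dense] by (auto simp: K_def cinner_expand algebra_simps)
    also have "\<dots> \<longleftrightarrow> (\<forall>h. cinner h f = cinner (R h) g)"
      by (metis R RK)
    also have "\<dots> \<longleftrightarrow> f = Q g"
      unfolding Q using cinner_ext by metis
    finally show ?thesis .
  qed
  then have inv: "op_inverse (op_diff (op_adjoint T) (op_scale \<i> Some)) = (\<lambda>g. Some (Q g))"
    by (auto simp: op_inverse_def)
  have adj: "op_adjoint (\<lambda>g. Some (Q g)) = (\<lambda>g. Some (R g))"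
    by (rule ext) (subst op_adjoint_eq_Some_iff, simp_all add: dom_def Q')
  define B where "B h = (1 / (2 * \<i>)) *\<^sub>C (Q h - R h)" for h
  have Im_eq: "op_Im (\<lambda>g. Some (Q g)) = (\<lambda>h. Some (B h))"
    by (auto simp: op_Im_def adj op_scale_def op_diff_def B_def dom_def)
  have B_form: "cinner (B h) h = of_real ((norm (R h, \<Gamma> \<cdot> R h))\<^sup>2)" for h
  proof -
    define u where "u = R h"
    have u: "u \<in> dom T" "K u = h"
      using R by (simp_all add: u_def)
    have "cinner (B h) h = (1 / (2 * \<i>)) * (cinner h u - cnj (cinner h u))"
      using Q'[of h h] cinner_commute[of u h] by (simp add: B_def cinner_expand u_def)
    also have "\<dots> = of_real (Im (cinner h u))"
      by (simp add: complex_eq_iff)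
    also have "Im (cinner h u) = im_form T u + (norm u)\<^sup>2"
      using Im_cinner_shift[of T u "- \<i>"] u(2) by (simp add: K_def)
    also have "\<dots> = (norm (u, \<Gamma> \<cdot> u))\<^sup>2"
      by (simp add: boundary_pair_im_form[OF bp u(1)] norm_Pair)
    finally show ?thesis
      by (simp add: u_def)
  qed
  have "nonneg_map B"
    unfolding nonneg_map_def
  proof (intro conjI exI allI)
    show "clinear_on UNIV B"
      using linQ linR unfolding clinear_on_def B_def
      by (simp add: scaleC_scaleC mult.commute complex_vector.scale_right_diff_distrib scaleC_add_right)
    show "norm (B h) \<le> 1 * norm h" for h
      using norm_triangle_ineq4[of "Q h" "R h"] Q_le[of h] R_le[of h]
      by (simp add: B_def norm_scaleC norm_divide norm_mult)
    show "cinner (B h) h \<in> \<real>\<^sub>\<ge>\<^sub>0" for h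
      by (simp add: B_form complex_nonneg_Reals_iff)
  qed
  then obtain S where S: "nonneg_map S" "\<And>h. S (S h) = B h"
    "op_sqrt (\<lambda>x. Some (B x)) = (\<lambda>x. Some (S x))"
    using op_sqrt_Some by blast
  have L: "L_space T = range S"
    by (simp add: L_space_def inv Im_eq S(3) ran_Some)
  have norm_S: "norm (S h) = norm (R h, \<Gamma> \<cdot> R h)" for h
  proof -
    have "of_real ((norm (S h))\<^sup>2) = cinner (B h) h"
      using nonneg_map_symmetric[OF S(1), of "S h" h] by (simp add: S(2) cinner_self)
    then have "(norm (S h))\<^sup>2 = (norm (R h, \<Gamma> \<cdot> R h))\<^sup>2"
      unfolding B_form using of_real_eq_iff by blast
    then show ?thesis
      by (simp add: power2_eq_iff_nonneg)
  qed
  have "g \<in> range S \<longleftrightarrow> (\<exists>C. \<forall>f\<in>dom T. cmod (cinner (K f) g) \<le> C * norm (f, \<Gamma> \<cdot> f))" for g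
  proof -
    have "g \<in> range S \<longleftrightarrow> (\<exists>C. \<forall>h. cmod (cinner h g) \<le> C * norm (R h, \<Gamma> \<cdot> R h))"
      using range_symmetric_iff[OF nonneg_map_linear[OF S(1)] nonneg_map_symmetric[OF S(1)]]
      by (simp add: norm_S)
    moreover have "(\<forall>h. cmod (cinner h g) \<le> C * norm (R h, \<Gamma> \<cdot> R h))
        \<longleftrightarrow> (\<forall>f\<in>dom T. cmod (cinner (K f) g) \<le> C * norm (f, \<Gamma> \<cdot> f))" for C
      by (metis R RK)
    ultimately show ?thesis
      by simp
  qed
  then show ?thesis
    using L shift_dominated_iff[of T "- \<i>" _ \<Gamma>] by (auto simp: K_def)
qed

section \<open>The square of the symmetric operator\<close>

lemma singular_approx:
  fixes T :: "'h::complex_hilbert \<rightharpoonup> 'h" and \<Gamma> :: "'h \<rightharpoonup> 'e::complex_hilbert"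
  assumes sing: "D_sing T" and bp: "boundary_pair T \<Gamma>" and f: "f \<in> dom T"
  obtains F where "\<And>n. F n \<in> dom T" "F \<longlonglongrightarrow> f" "(\<lambda>n. \<Gamma> \<cdot> F n) \<longlonglongrightarrow> 0"
proof -
  obtain F :: "nat \<Rightarrow> 'h" where F: "range F \<subseteq> dom T" "F \<longlonglongrightarrow> f" "(\<lambda>n. im_form T (F n)) \<longlonglongrightarrow> 0"
    using sing f unfolding D_sing_def by blast
  have mem: "F n \<in> dom T" for n
    using F(1) by blast
  have "(\<lambda>n. sqrt (im_form T (F n))) \<longlonglongrightarrow> 0"
    using tendsto_real_sqrt[OF F(3)] by simp
  then have "(\<lambda>n. norm (\<Gamma> \<cdot> F n)) \<longlonglongrightarrow> 0"
    by (simp add: boundary_pair_im_form[OF bp mem])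
  then show thesis
    using that mem F(2) tendsto_norm_zero_iff by blast
qed

text \<open>
  For \<open>f\<close> in both domains with adjoint value \<open>h\<close>, Green's identity reads
  \<open>cinner u (h - T f) = 2 * \<i> * cinner (\<Gamma> u) (\<Gamma> f)\<close>. The left side is continuous in \<open>u\<close>, while
  by singularity every \<open>u\<close> is a limit of vectors along which \<open>\<Gamma>\<close> tends to \<open>0\<close>. So both sides vanish.
\<close>

lemma dom_Int_dom_adjoint_eq_kernel:
  fixes T :: "'h::complex_hilbert \<rightharpoonup> 'h" and \<Gamma> :: "'h \<rightharpoonup> 'e::complex_hilbert"
  assumes sing: "D_sing T" and bp: "boundary_pair T \<Gamma>"
  shows "dom T \<inter> dom (op_adjoint T) = {f\<in>dom T. \<Gamma> \<cdot> f = 0}"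
proof -
  have dense: "closure (dom T) = UNIV"
    using bp by (simp add: boundary_pair_def maximal_dissipative_def)
  have Green: "cinner (T \<cdot> u) f - cinner u (T \<cdot> f) = 2 * \<i> * cinner (\<Gamma> \<cdot> u) (\<Gamma> \<cdot> f)"
    if "u \<in> dom T" "f \<in> dom T" for u f
    using bp that by (simp add: boundary_pair_def)
  have "f \<in> dom (op_adjoint T)" if f: "f \<in> dom T" "\<Gamma> \<cdot> f = 0" for f
  proof -
    have "op_adjoint T f = Some (T \<cdot> f)"
      using Green[OF _ f(1)] f(2) by (simp add: op_adjoint_eq_Some_iff[OF dense])
    then show ?thesis
      by blast
  qed
  moreover have "\<Gamma> \<cdot> f = 0" if f: "f \<in> dom T" "f \<in> dom (op_adjoint T)" for f
  proof -
    obtain h where "op_adjoint T f = Some h"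
      using f(2) by blast
    then have h: "cinner (T \<cdot> u) f = cinner u h" if "u \<in> dom T" for u
      using that by (simp add: op_adjoint_eq_Some_iff[OF dense])
    have form: "cinner u (h - T \<cdot> f) = 2 * \<i> * cinner (\<Gamma> \<cdot> u) (\<Gamma> \<cdot> f)" if "u \<in> dom T" for u
      using Green[OF that f(1)] h[OF that] by (simp add: cinner_diff_right)
    have "cinner u (h - T \<cdot> f) = 0" if u: "u \<in> dom T" for u
    proof -
      obtain F where F: "\<And>n. F n \<in> dom T" "F \<longlonglongrightarrow> u" "(\<lambda>n. \<Gamma> \<cdot> F n) \<longlonglongrightarrow> 0"
        using singular_approx[OF sing bp u] by blast
      have "(\<lambda>n. cinner (F n) (h - T \<cdot> f)) \<longlonglongrightarrow> cinner u (h - T \<cdot> f)"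
        by (intro tendsto_cinner F tendsto_const)
      moreover have "(\<lambda>n. 2 * \<i> * cinner (\<Gamma> \<cdot> F n) (\<Gamma> \<cdot> f)) \<longlonglongrightarrow> 2 * \<i> * cinner 0 (\<Gamma> \<cdot> f)"
        by (intro tendsto_mult tendsto_cinner F tendsto_const)
      ultimately have "cinner u (h - T \<cdot> f) = 2 * \<i> * cinner 0 (\<Gamma> \<cdot> f)"
        unfolding form[OF F(1)] by (rule LIMSEQ_unique)
      then show ?thesis
        by simp
    qed
    then have "cinner (\<Gamma> \<cdot> f) (\<Gamma> \<cdot> f) = 0"
      using form[OF f(1)] f(1) by simp
    then show ?thesis
      by (simp add: cinner_self_eq_0)
  qed
  ultimately show ?thesis
    by blast
qed

lemma clinear_on_vimage_subspace:
  assumes f: "clinear_on N f" and M: "complex_vector.subspace M"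
  shows "complex_vector.subspace {x\<in>N. f x \<in> M}"
proof (rule complex_vector.subspaceI)
  note sub = clinear_on_subspace[OF f]
  have "f 0 = 0"
    using clinear_on_diff[OF f, of 0 0] complex_vector.subspace_0[OF sub] by simp
  then show "0 \<in> {x\<in>N. f x \<in> M}"
    using complex_vector.subspace_0[OF sub] complex_vector.subspace_0[OF M] by simp
qed (use f M clinear_on_subspace[OF f] in
    \<open>simp_all add: clinear_on_add clinear_on_scaleC complex_vector.subspace_add complex_vector.subspace_scale\<close>)

text \<open>
  The parametrization of \<open>dom (T_z T \<Gamma> z)\<close> by \<open>dom T\<close>.
\<close>

definition Tz_vec :: "('h \<rightharpoonup> 'e::complex_inner) \<Rightarrow> complex \<Rightarrow> 'h::complex_inner \<Rightarrow> 'h \<times> 'e"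
  where "Tz_vec \<Gamma> z f = (f, - ((\<Gamma> \<cdot> f) /\<^sub>R sqrt (Im z)))"

lemma Tz_vec_linear:
  assumes "linear_op \<Gamma>"
  shows "clinear_on (dom \<Gamma>) (Tz_vec \<Gamma> z)"
  using assms unfolding linear_op_clinear_on clinear_on_def Tz_vec_def
  by (simp add: scaleC_prod_def scaleR_eq_scaleC scaleC_add_right scaleC_scaleC mult.commute
      complex_vector.scale_minus_right)

lemma cinner_Tz_vec:
  "cinner (Tz_vec \<Gamma> z f) (p, q) = cinner f p - cinner (\<Gamma> \<cdot> f) q / sqrt (Im z)"
  by (simp add: Tz_vec_def cinner_prod_def cinner_expand divide_inverse mult.commute)

text \<open>
  By singularity the second component can be switched off in the limit, so the first component of
  \<open>w\<close> is orthogonal to \<open>dom T\<close>; then the second one is orthogonal to the range of \<open>\<Gamma>\<close>.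
\<close>

lemma Tz_vec_total:
  fixes T :: "'h::complex_hilbert \<rightharpoonup> 'h" and \<Gamma> :: "'h \<rightharpoonup> 'e::complex_hilbert"
  assumes sing: "D_sing T" and bp: "boundary_pair T \<Gamma>" and z: "Im z > 0"
    and orth: "\<And>f. f \<in> dom T \<Longrightarrow> cinner (Tz_vec \<Gamma> z f) w = 0"
  shows "w = 0"
proof -
  obtain p q where w: "w = (p, q)"
    by fastforce
  have eq: "cinner f p = cinner (\<Gamma> \<cdot> f) q / sqrt (Im z)" if "f \<in> dom T" for f
    using orth[OF that] by (simp add: w cinner_Tz_vec)
  have "cinner f p = 0" if f: "f \<in> dom T" for f
  proof -
    obtain F where F: "\<And>n. F n \<in> dom T" "F \<longlonglongrightarrow> f" "(\<lambda>n. \<Gamma> \<cdot> F n) \<longlonglongrightarrow> 0"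
      using singular_approx[OF sing bp f] by blast
    have "(\<lambda>n. cinner (F n) p) \<longlonglongrightarrow> cinner f p"
      by (intro tendsto_cinner F tendsto_const)
    moreover have "(\<lambda>n. cinner (\<Gamma> \<cdot> F n) q / sqrt (Im z)) \<longlonglongrightarrow> cinner 0 q / sqrt (Im z)"
      by (intro tendsto_divide tendsto_cinner F tendsto_const) (use z in auto)
    ultimately show ?thesis
      using LIMSEQ_unique by (simp add: eq F(1))
  qed
  then have p: "p = 0"
    using bp by (intro cinner_eq_0_if_orth_dense[of "dom T"])
      (auto simp: boundary_pair_def maximal_dissipative_def)
  have "q = 0"
  proof (rule cinner_eq_0_if_orth_dense)
    show "closure (ran \<Gamma>) = UNIV"
      using bp by (simp add: boundary_pair_def)
    fix e
    assume "e \<in> ran \<Gamma>"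
    then obtain f where f: "\<Gamma> f = Some e"
      by (auto simp: ran_def)
    then have "f \<in> dom T"
      using bp by (auto simp: boundary_pair_def)
    then show "cinner e q = 0"
      using eq[of f] f p z by simp
  qed
  then show ?thesis
    by (simp add: w p zero_prod_def)
qed

lemma dom_T_z_square:
  fixes T :: "'h::complex_hilbert \<rightharpoonup> 'h" and \<Gamma> :: "'h \<rightharpoonup> 'e::complex_hilbert"
  assumes bp: "boundary_pair T \<Gamma>" and z: "Im z > 0"
  shows "dom (T_z T \<Gamma> z \<circ>\<^sub>m T_z T \<Gamma> z)
    = Tz_vec \<Gamma> z ` {f\<in>dom T. T \<cdot> f - cnj z *\<^sub>C f \<in> {k\<in>dom T. \<Gamma> \<cdot> k = 0}}"
proof -
  have linG: "clinear_on (dom T) (\<lambda>f. \<Gamma> \<cdot> f)"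
    using bp by (metis boundary_pair_def linear_op_clinear_on)
  note sub = clinear_on_subspace[OF linG]
  have cancel: "- (a /\<^sub>R sqrt (Im z)) = - (b /\<^sub>R sqrt (Im z)) \<longleftrightarrow> a = b" for a b :: 'e
    using z by simp
  have twice: "T \<cdot> f \<in> dom T \<and> cnj z *\<^sub>C (\<Gamma> \<cdot> f) = \<Gamma> \<cdot> (T \<cdot> f)
      \<longleftrightarrow> T \<cdot> f - cnj z *\<^sub>C f \<in> {k\<in>dom T. \<Gamma> \<cdot> k = 0}" if f: "f \<in> dom T" for f
  proof -
    have zf: "cnj z *\<^sub>C f \<in> dom T"
      using sub f by (rule complex_vector.subspace_scale)
    have dom_iff: "T \<cdot> f - cnj z *\<^sub>C f \<in> dom T \<longleftrightarrow> T \<cdot> f \<in> dom T"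
      using complex_vector.subspace_add[OF sub _ zf, of "T \<cdot> f - cnj z *\<^sub>C f"]
        complex_vector.subspace_diff[OF sub _ zf, of "T \<cdot> f"] by (simp only: diff_add_cancel) blast
    show ?thesis
    proof (cases "T \<cdot> f \<in> dom T")
      case True
      then have "\<Gamma> \<cdot> (T \<cdot> f - cnj z *\<^sub>C f) = \<Gamma> \<cdot> (T \<cdot> f) - cnj z *\<^sub>C (\<Gamma> \<cdot> f)"
        using zf f by (simp add: clinear_on_diff[OF linG] clinear_on_scaleC[OF linG])
      then have "\<Gamma> \<cdot> (T \<cdot> f - cnj z *\<^sub>C f) = 0 \<longleftrightarrow> cnj z *\<^sub>C (\<Gamma> \<cdot> f) = \<Gamma> \<cdot> (T \<cdot> f)"
        by auto
      then show ?thesis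
        using True dom_iff by blast
    next
      case False
      then show ?thesis
        using dom_iff by blast
    qed
  qed
  have "(p, q) \<in> dom (T_z T \<Gamma> z \<circ>\<^sub>m T_z T \<Gamma> z) \<longleftrightarrow> p \<in> dom T \<and> q = - ((\<Gamma> \<cdot> p) /\<^sub>R sqrt (Im z)) \<and>
      T \<cdot> p \<in> dom T \<and> cnj z *\<^sub>C (\<Gamma> \<cdot> p) = \<Gamma> \<cdot> (T \<cdot> p)" for p q
    using cancel[of "cnj z *\<^sub>C (\<Gamma> \<cdot> p)" "\<Gamma> \<cdot> (T \<cdot> p)"]
    by (auto simp: map_comp_def T_z_def dom_def split: if_splits)
  then have mem: "(p, q) \<in> dom (T_z T \<Gamma> z \<circ>\<^sub>m T_z T \<Gamma> z) \<longleftrightarrow> (p, q)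
      \<in> Tz_vec \<Gamma> z ` {f\<in>dom T. T \<cdot> f - cnj z *\<^sub>C f \<in> {k\<in>dom T. \<Gamma> \<cdot> k = 0}}" for p q
    using twice[of p] unfolding Tz_vec_def image_iff by blast
  show ?thesis
    by (rule set_eqI, rule prod.exhaust, erule ssubst, rule mem)
qed

text \<open>
  The imaginary part of \<open>cinner (T f - cnj z f) f\<close> is exactly \<open>Im z\<close> times the squared norm of the
  vector: the weight \<open>1 / sqrt (Im z)\<close> is the one for which the boundary term fits.
\<close>

lemma norm_Tz_vec_le_shift:
  fixes T :: "'h::complex_hilbert \<rightharpoonup> 'h" and \<Gamma> :: "'h \<rightharpoonup> 'e::complex_hilbert"
  assumes bp: "boundary_pair T \<Gamma>" and z: "Im z > 0" and f: "f \<in> dom T"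
  shows "Im z * norm (Tz_vec \<Gamma> z f) \<le> norm (T \<cdot> f - cnj z *\<^sub>C f)"
proof -
  define t where "t = norm (Tz_vec \<Gamma> z f)"
  have "Im z * t\<^sup>2 = Im z * (norm f)\<^sup>2 + (norm (\<Gamma> \<cdot> f))\<^sup>2"
    using z by (simp add: t_def Tz_vec_def norm_Pair power_mult_distrib power_inverse field_simps)
  also have "\<dots> = Im (cinner (T \<cdot> f - cnj z *\<^sub>C f) f)"
    by (simp add: Im_cinner_shift boundary_pair_im_form[OF bp f])
  also have "\<dots> \<le> norm (T \<cdot> f - cnj z *\<^sub>C f) * norm f"
    using abs_Im_le_cmod[of "cinner (T \<cdot> f - cnj z *\<^sub>C f) f"]
      cinner_cauchy_schwarz[of "T \<cdot> f - cnj z *\<^sub>C f" f] by linarith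
  also have "\<dots> \<le> norm (T \<cdot> f - cnj z *\<^sub>C f) * t"
    using norm_fst_le[of f] by (intro mult_left_mono) (simp_all add: t_def Tz_vec_def)
  finally have "(Im z * t) * t \<le> norm (T \<cdot> f - cnj z *\<^sub>C f) * t"
    by (simp add: power2_eq_square mult.assoc)
  moreover have "t \<ge> 0"
    by (simp add: t_def)
  ultimately have "Im z * t \<le> norm (T \<cdot> f - cnj z *\<^sub>C f)"
    by (cases "t = 0") (simp, rule mult_right_le_imp_le[of _ t], auto)
  then show ?thesis
    by (simp add: t_def)
qed

lemma norm_Pair_le_Tz_vec:
  assumes z: "Im z > 0"
  shows "norm (f, \<Gamma> \<cdot> f) \<le> (1 + sqrt (Im z)) * norm (Tz_vec \<Gamma> z f)"
proof -
  have "norm (\<Gamma> \<cdot> f) = sqrt (Im z) * norm (- ((\<Gamma> \<cdot> f) /\<^sub>R sqrt (Im z)))"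
    using z by (simp add: field_simps)
  also have "\<dots> \<le> sqrt (Im z) * norm (Tz_vec \<Gamma> z f)"
    unfolding Tz_vec_def using z by (intro mult_left_mono norm_snd_le) simp
  finally have "norm (\<Gamma> \<cdot> f) \<le> sqrt (Im z) * norm (Tz_vec \<Gamma> z f)" .
  moreover have "norm f \<le> norm (Tz_vec \<Gamma> z f)"
    unfolding Tz_vec_def by (rule norm_fst_le)
  ultimately show ?thesis
    using norm_Pair_le[of f "\<Gamma> \<cdot> f"] by (simp add: distrib_right)
qed

lemma norm_Tz_vec_le_Pair:
  "norm (Tz_vec \<Gamma> z f) \<le> (1 + \<bar>inverse (sqrt (Im z))\<bar>) * norm (f, \<Gamma> \<cdot> f)"
proof -
  have "norm (- ((\<Gamma> \<cdot> f) /\<^sub>R sqrt (Im z))) \<le> \<bar>inverse (sqrt (Im z))\<bar> * norm (f, \<Gamma> \<cdot> f)"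
    unfolding norm_minus_cancel norm_scaleR by (intro mult_left_mono norm_snd_le) simp
  moreover have "norm f \<le> norm (f, \<Gamma> \<cdot> f)"
    by (rule norm_fst_le)
  ultimately show ?thesis
    using norm_Pair_le[of f "- ((\<Gamma> \<cdot> f) /\<^sub>R sqrt (Im z))"] by (simp add: distrib_right Tz_vec_def)
qed

text \<open>
  Membership in \<open>L_space T\<close>, rewritten with the data of \<open>T_z T \<Gamma> z\<close>: the shift by \<open>cnj z\<close> is
  absorbed by \<open>shift_dominated_iff\<close>, and the norms of \<open>(f, \<Gamma> f)\<close> and \<open>Tz_vec \<Gamma> z f\<close> are equivalent.
\<close>

lemma in_L_space_iff:
  fixes T :: "'h::complex_hilbert \<rightharpoonup> 'h" and \<Gamma> :: "'h \<rightharpoonup> 'e::complex_hilbert"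
  assumes bp: "boundary_pair T \<Gamma>" and z: "Im z > 0"
  shows "g \<in> L_space T \<longleftrightarrow>
    (\<exists>C. \<forall>f\<in>dom T. cmod (cinner (T \<cdot> f - cnj z *\<^sub>C f) g) \<le> C * norm (Tz_vec \<Gamma> z f))"
proof -
  have trans: "\<exists>C. \<forall>f\<in>dom T. p f \<le> C * b f"
    if C: "\<forall>f\<in>dom T. p f \<le> C * a f" and D: "\<And>f. a f \<le> D * b f"
      and a: "\<And>f. a f \<ge> 0" for p a b :: "'h \<Rightarrow> real" and C D
  proof (intro exI ballI)
    fix f
    assume "f \<in> dom T"
    then have "p f \<le> C * a f"
      using C by blast
    also have "\<dots> \<le> \<bar>C\<bar> * a f"
      using a by (intro mult_right_mono) auto
    also have "\<dots> \<le> \<bar>C\<bar> * (D * b f)"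
      by (intro mult_left_mono D) simp
    finally show "p f \<le> (\<bar>C\<bar> * D) * b f"
      by (simp add: mult.assoc)
  qed
  have "g \<in> L_space T \<longleftrightarrow>
      (\<exists>C. \<forall>f\<in>dom T. cmod (cinner (T \<cdot> f - cnj z *\<^sub>C f) g) \<le> C * norm (f, \<Gamma> \<cdot> f))"
    unfolding L_space_eq[OF bp] shift_dominated_iff by simp
  also have "\<dots> \<longleftrightarrow>
      (\<exists>C. \<forall>f\<in>dom T. cmod (cinner (T \<cdot> f - cnj z *\<^sub>C f) g) \<le> C * norm (Tz_vec \<Gamma> z f))"
  proof
    assume "\<exists>C. \<forall>f\<in>dom T. cmod (cinner (T \<cdot> f - cnj z *\<^sub>C f) g) \<le> C * norm (f, \<Gamma> \<cdot> f)"
    then obtain C where C: "\<forall>f\<in>dom T. cmod (cinner (T \<cdot> f - cnj z *\<^sub>C f) g) \<le> C * norm (f, \<Gamma> \<cdot> f)"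
      by blast
    show "\<exists>C. \<forall>f\<in>dom T. cmod (cinner (T \<cdot> f - cnj z *\<^sub>C f) g) \<le> C * norm (Tz_vec \<Gamma> z f)"
      by (rule trans[where a = "\<lambda>f. norm (f, \<Gamma> \<cdot> f)", OF C])
        (rule norm_Pair_le_Tz_vec[OF z], rule norm_ge_zero)
  next
    assume "\<exists>C. \<forall>f\<in>dom T. cmod (cinner (T \<cdot> f - cnj z *\<^sub>C f) g) \<le> C * norm (Tz_vec \<Gamma> z f)"
    then obtain C where C: "\<forall>f\<in>dom T. cmod (cinner (T \<cdot> f - cnj z *\<^sub>C f) g) \<le> C * norm (Tz_vec \<Gamma> z f)"
      by blast
    show "\<exists>C. \<forall>f\<in>dom T. cmod (cinner (T \<cdot> f - cnj z *\<^sub>C f) g) \<le> C * norm (f, \<Gamma> \<cdot> f)"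
      by (rule trans[where a = "\<lambda>f. norm (Tz_vec \<Gamma> z f)", OF C])
        (rule norm_Tz_vec_le_Pair, rule norm_ge_zero)
  qed
  finally show ?thesis .
qed

text \<open>
  Both directions transport a nonzero vector along the relation
  \<open>cinner (j f) w = cinner (K f) g\<close>: the partner exists by \<open>dominated_functional_repr\<close>, it is nonzero
  because the vectors \<open>j f\<close> are total and \<open>K\<close> is onto, and on the preimage of \<open>D0\<close> under \<open>K\<close> the two
  orthogonality conditions are the two sides of the relation.
\<close>

lemma T_z_square_dense_iff:
  fixes T :: "'h::complex_hilbert \<rightharpoonup> 'h" and \<Gamma> :: "'h \<rightharpoonup> 'e::complex_hilbert"
  assumes sing: "D_sing T" and bp: "boundary_pair T \<Gamma>" and z: "Im z > 0"
  shows "closure (dom (T_z T \<Gamma> z \<circ>\<^sub>m T_z T \<Gamma> z)) = UNIV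
    \<longleftrightarrow> L_space T \<inter> orth_compl (dom T \<inter> dom (op_adjoint T)) = {0}"
proof -
  have T: "maximal_dissipative T" and linop: "linear_op \<Gamma>" and dom: "dom \<Gamma> = dom T"
    using bp by (simp_all add: boundary_pair_def)
  note linT = maximal_dissipative_linear[OF T]
  define j where "j = Tz_vec \<Gamma> z"
  define K where "K f = T \<cdot> f - cnj z *\<^sub>C f" for f
  define D0 where "D0 = {k\<in>dom T. \<Gamma> \<cdot> k = 0}"
  have linj: "clinear_on (dom T) j"
    unfolding j_def using Tz_vec_linear[OF linop] by (simp add: dom)
  have linK: "clinear_on (dom T) K"
    unfolding K_def by (rule clinear_on_shift[OF linT])
  have K_surj: "\<exists>f\<in>dom T. K f = h" for h
    unfolding K_def by (rule maximal_dissipative_shift_surj[OF T, of "cnj z" h]) (use z in auto)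
  have D0_sub: "complex_vector.subspace D0"
    using clinear_on_vimage_subspace[of "dom T" "\<lambda>f. \<Gamma> \<cdot> f" "{0}"] linop
      complex_vector.subspace_single_0 by (simp add: D0_def dom linear_op_clinear_on)
  have D0: "dom T \<inter> dom (op_adjoint T) = D0"
    unfolding D0_def by (rule dom_Int_dom_adjoint_eq_kernel[OF sing bp])
  define N where "N = {f\<in>dom T. K f \<in> D0}"
  have V: "dom (T_z T \<Gamma> z \<circ>\<^sub>m T_z T \<Gamma> z) = j ` N"
    unfolding N_def K_def j_def D0_def by (rule dom_T_z_square[OF bp z])
  have N_sub: "complex_vector.subspace N"
    unfolding N_def by (rule clinear_on_vimage_subspace[OF linK D0_sub])
  have "clinear_on N j"
    using linj N_sub by (simp add: clinear_on_def N_def)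
  then have V_sub: "complex_vector.subspace (j ` N)"
    by (rule clinear_on_image_subspace)
  have L: "g \<in> L_space T \<longleftrightarrow> (\<exists>C. \<forall>f\<in>dom T. cmod (cinner (K f) g) \<le> C * norm (j f))" for g
    unfolding K_def j_def by (rule in_L_space_iff[OF bp z])
  have "closure (j ` N) \<noteq> UNIV \<longleftrightarrow> (\<exists>g. g \<noteq> 0 \<and> g \<in> L_space T \<inter> orth_compl D0)"
  proof
    assume "closure (j ` N) \<noteq> UNIV"
    then obtain w where w: "w \<noteq> 0" "\<And>v. v \<in> j ` N \<Longrightarrow> cinner v w = 0"
      using nondense_subspace_orth[OF V_sub] by blast
    have "cmod (cinner (j f) w) \<le> (norm w / Im z) * norm (K f)" if f: "f \<in> dom T" for f
    proof -
      have "norm (j f) \<le> norm (K f) / Im z"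
        using norm_Tz_vec_le_shift[OF bp z f] z by (simp add: j_def K_def field_simps)
      then have "norm (j f) * norm w \<le> norm (K f) / Im z * norm w"
        by (rule mult_right_mono) simp
      then show ?thesis
        using cinner_cauchy_schwarz[of "j f" w] by (simp add: mult.commute)
    qed
    then obtain g where g: "\<And>f. f \<in> dom T \<Longrightarrow> cinner (j f) w = cinner (K f) g"
      using dominated_functional_repr[OF linj linK] by blast
    have "g \<noteq> 0"
      using Tz_vec_total[OF sing bp z, of w] g w(1) by (auto simp: j_def)
    moreover have "g \<in> L_space T"
      unfolding L
    proof (intro exI ballI)
      fix f
      assume "f \<in> dom T"
      then show "cmod (cinner (K f) g) \<le> norm w * norm (j f)"
        using cinner_cauchy_schwarz[of "j f" w] g by (simp add: mult.commute)
    qed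
    moreover have "g \<in> orth_compl D0"
      unfolding orth_compl_def
    proof (intro CollectI ballI)
      fix h
      assume "h \<in> D0"
      moreover obtain f where "f \<in> dom T" "K f = h"
        using K_surj by blast
      ultimately have "cinner h g = 0"
        using g[of f] w(2)[of "j f"] by (simp add: N_def)
      then show "cinner g h = 0"
        by (metis cinner_commute complex_cnj_zero)
    qed
    ultimately show "\<exists>g. g \<noteq> 0 \<and> g \<in> L_space T \<inter> orth_compl D0"
      by blast
  next
    assume "\<exists>g. g \<noteq> 0 \<and> g \<in> L_space T \<inter> orth_compl D0"
    then obtain g C where g: "g \<noteq> 0" "g \<in> orth_compl D0"
      and C: "\<And>f. f \<in> dom T \<Longrightarrow> cmod (cinner (K f) g) \<le> C * norm (j f)"
      using L by blast
    obtain w where w: "\<And>f. f \<in> dom T \<Longrightarrow> cinner (K f) g = cinner (j f) w"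
      using dominated_functional_repr[OF linK linj C] by blast
    show "closure (j ` N) \<noteq> UNIV"
    proof
      assume dense: "closure (j ` N) = UNIV"
      have "w = 0"
      proof (rule cinner_eq_0_if_orth_dense[OF dense])
        fix v
        assume "v \<in> j ` N"
        then obtain f where f: "f \<in> dom T" "K f \<in> D0" "v = j f"
          by (auto simp: N_def)
        have "cinner g (K f) = 0"
          using g(2) f(2) by (simp add: orth_compl_def)
        then show "cinner v w = 0"
          using w[OF f(1)] f(3) by (metis cinner_commute complex_cnj_zero)
      qed
      moreover obtain f where "f \<in> dom T" "K f = g"
        using K_surj by blast
      ultimately have "cinner g g = 0"
        using w[of f] by simp
      then show False
        using g(1) by (simp add: cinner_self_eq_0)
    qed
  qed
  moreover have "0 \<in> L_space T \<inter> orth_compl D0"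
  proof
    show "0 \<in> L_space T"
      unfolding L by (intro exI[of _ 0]) simp
  qed (simp add: orth_compl_def)
  ultimately show ?thesis
    unfolding V D0 by blast
qed


theorem theorem8p7:
  fixes T :: "'h::complex_hilbert \<rightharpoonup> 'h"
    and \<Gamma> :: "'h \<rightharpoonup> 'e::complex_hilbert"
    and z :: complex
  assumes "D_sing T"
    and "\<not> bounded_op T"
    and "dom T \<inter> dom (op_adjoint T) \<noteq> {0}"
    and "closure (dom T \<inter> dom (op_adjoint T)) \<noteq> UNIV"
    and "boundary_pair T \<Gamma>"
    and "Im z > 0"
  shows "(closure (dom (T_z T \<Gamma> z \<circ>\<^sub>m T_z T \<Gamma> z)) = UNIV \<longleftrightarrow>
            L_space T \<inter> orth_compl (dom T \<inter> dom (op_adjoint T)) = {0}) \<and>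
         (closure (dom (T_z T \<Gamma> z \<circ>\<^sub>m T_z T \<Gamma> z)) \<noteq> UNIV \<longleftrightarrow>
            L_space T \<inter> orth_compl (dom T \<inter> dom (op_adjoint T)) \<noteq> {0})"
  using T_z_square_dense_iff[OF assms(1,5,6)] by blast

end
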